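(* Let $X$ be an infinite connected graph with bounded degree, with vertex set $V$ and edge set $E$, that contains a Morse quasi-geodesic $\gamma$. Let $\nu$ be a probability measure on $[0,\infty)$ with $\nu(\{0\})=0$ such that, if the lengths $(\omega(e))_{e\in E}$ are chosen independently with law $\nu$, then $\mathbb{E}\, e^{c\,\omega(e)}<\infty$ for some $c>0$. Then for almost every $\omega$, the weighted graph $X_\omega$ admits a bi-infinite geodesic. Moreover, for every sequence of pairs of vertices $(x_n,y_n)$ of $\gamma$ going to infinity on opposite sides of $\gamma$, for almost every $\omega$ there exists a finite subset $A\subset V$ such that for all $n$ the $\omega$-geodesic between $x_n$ and $y_n$ (any $\omega$-geodesic between them, if it is not unique) crosses $A$, i.e. passes through a vertex of $A$.
   Context: Graphs are non-oriented and simple (no double edges). $d$ denotes the graph metric on $V$. Paths: a path $\gamma=(e_1,\dots,e_n)$ between vertices $x,y$ is a sequence of consecutive edges joining $x$ to $y$; its vertices are $x=\gamma(0),\dots,\gamma(n)=y$, where $e_{i+1}$ joins $\gamma(i)$ and $\gamma(i+1)$; its length is $|\gamma|=n$, and $\gamma([i,j])$ is the subpath $(e_{i+1},\dots,e_j)$ for $i<j$. Infinite paths (indexed by $\mathbb{N}$) and bi-infinite paths (indexed by $\mathbb{Z}$) are defined similarly. First passage percolation: $\Omega=[0,\infty)^E$ is equipped with the product probability $P$ of copies of $\nu$ (so the edge lengths $\omega(e)$ are i.i.d. with law $\nu$); $\mathbb{E}$ is expectation with respect to $P$, and "almost every $\omega$" refers to $P$. For a finite path $\gamma=(e_1,\dots,e_m)$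 let $|\gamma|_\omega=\sum_{i=1}^m\omega(e_i)$, and let $d_\omega(v_1,v_2)$ be the infimum of $|\gamma|_\omega$ over all paths $\gamma$ joining $v_1$ to $v_2$. $X_\omega$ denotes the graph $X$ with edge $e$ weighted by $\omega(e)$, with metric $d_\omega$. An $\omega$-geodesic between $x$ and $y$ is a finite path $\gamma$ joining them with $|\gamma|_\omega=d_\omega(x,y)$. A bi-infinite geodesic of $X_\omega$ is a bi-infinite path $\gamma$ such that $|\gamma([i,j])|_\omega=d_\omega(\gamma(i),\gamma(j))$ for all integers $i<j$. Quasi-geodesics (for the graph metric $d$): for $C\ge 1$, $K\ge 0$, a path $\gamma$ (finite of length $n$, infinite, or bi-infinite) is $(C,K)$-quasi-geodesic if $j-i\le C\,d(\gamma(i),\gamma(j))+K$ for all indices $i<j$ of the path ($0\le i<j\le n$ in the finite case). An infinite or bi-infinite path is a quasi-geodesic if it is $(C,K)$-quasi-geodesic for some $C,K$. A Morse quasi-geodesic is a bi-infinite quasi-geodesic $\gamma$ in $X$ such that for all $C\ge1$ and $K>0$ there exists $R$ such that every $(C,K)$-quasi-geodesic finite path joining two points of $\gamma$ remains inside the $R$-neighborhood of $\gamma$ (with respect to $d$). "$(x_n,y_n)$ going to infinity on opposite sides of $\gamma$" means that $x_n=\gamma(s_n)$, $y_n=\gamma(t_n)$ with $s_n\to-\infty$ and $t_n\to+\infty$ (or vice versa). *)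

theory Defs
  imports "HOL-Probability.Probability"
begin

text \<open>Edges are two-element sets of vertices, so loops, double edges and
  orientations are excluded by the representation.\<close>

definition simple_graph :: "'v set \<Rightarrow> 'v set set \<Rightarrow> bool" where
  "simple_graph V E \<longleftrightarrow> (\<forall>e\<in>E. e \<subseteq> V \<and> card e = 2)"

definition bounded_degree :: "'v set \<Rightarrow> 'v set set \<Rightarrow> bool" where
  "bounded_degree V E \<longleftrightarrow>
     (\<exists>D::nat. \<forall>v\<in>V. finite {e\<in>E. v \<in> e} \<and> card {e\<in>E. v \<in> e} \<le> D)"

text \<open>In a simple graph a path is determined by the sequence of its vertices. A finite path
  \<open>\<gamma> = (e\<^sub>1, \<dots>, e\<^sub>n)\<close> is represented by the list \<open>[\<gamma>(0), \<dots>, \<gamma>(n)]\<close>, with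
  \<open>e\<^sub>i\<^sub>+\<^sub>1 = {\<gamma>(i), \<gamma>(i+1)}\<close>; its length \<open>|\<gamma>|\<close> is one less than the length of the list. Vertices may
  be repeated, and \<open>[x]\<close> is the path without edges from \<open>x\<close> to itself.\<close>

definition finite_path :: "'v set \<Rightarrow> 'v set set \<Rightarrow> 'v list \<Rightarrow> bool" where
  "finite_path V E p \<longleftrightarrow>
     p \<noteq> [] \<and> set p \<subseteq> V \<and> (\<forall>i. Suc i < length p \<longrightarrow> {p ! i, p ! Suc i} \<in> E)"

definition path_between :: "'v set \<Rightarrow> 'v set set \<Rightarrow> 'v \<Rightarrow> 'v \<Rightarrow> 'v list \<Rightarrow> bool" where
  "path_between V E x y p \<longleftrightarrow> finite_path V E p \<and> hd p = x \<and> last p = y"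

definition path_length :: "'v list \<Rightarrow> nat" where
  "path_length p = length p - 1"

definition connected_graph :: "'v set \<Rightarrow> 'v set set \<Rightarrow> bool" where
  "connected_graph V E \<longleftrightarrow> (\<forall>x\<in>V. \<forall>y\<in>V. \<exists>p. path_between V E x y p)"

definition bi_infinite_path :: "'v set \<Rightarrow> 'v set set \<Rightarrow> (int \<Rightarrow> 'v) \<Rightarrow> bool" where
  "bi_infinite_path V E \<gamma> \<longleftrightarrow> (\<forall>i. \<gamma> i \<in> V \<and> {\<gamma> i, \<gamma> (i + 1)} \<in> E)"

definition graph_dist :: "'v set \<Rightarrow> 'v set set \<Rightarrow> 'v \<Rightarrow> 'v \<Rightarrow> nat" where
  "graph_dist V E x y = (INF p\<in>{p. path_between V E x y p}. path_length p)"

definition quasi_geodesic_finite ::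
    "'v set \<Rightarrow> 'v set set \<Rightarrow> real \<Rightarrow> real \<Rightarrow> 'v list \<Rightarrow> bool" where
  "quasi_geodesic_finite V E C K p \<longleftrightarrow> finite_path V E p \<and>
     (\<forall>i j. i < j \<and> j \<le> path_length p \<longrightarrow>
        real (j - i) \<le> C * real (graph_dist V E (p ! i) (p ! j)) + K)"

definition quasi_geodesic_bi_infinite ::
    "'v set \<Rightarrow> 'v set set \<Rightarrow> real \<Rightarrow> real \<Rightarrow> (int \<Rightarrow> 'v) \<Rightarrow> bool" where
  "quasi_geodesic_bi_infinite V E C K \<gamma> \<longleftrightarrow> bi_infinite_path V E \<gamma> \<and>
     (\<forall>i j. i < j \<longrightarrow> real_of_int (j - i) \<le> C * real (graph_dist V E (\<gamma> i) (\<gamma> j)) + K)"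

definition morse_quasi_geodesic :: "'v set \<Rightarrow> 'v set set \<Rightarrow> (int \<Rightarrow> 'v) \<Rightarrow> bool" where
  "morse_quasi_geodesic V E \<gamma> \<longleftrightarrow>
     (\<exists>C K. C \<ge> 1 \<and> K \<ge> 0 \<and> quasi_geodesic_bi_infinite V E C K \<gamma>) \<and>
     (\<forall>C K. C \<ge> 1 \<and> K > 0 \<longrightarrow>
        (\<exists>R::real. \<forall>p. quasi_geodesic_finite V E C K p \<and> hd p \<in> range \<gamma> \<and> last p \<in> range \<gamma> \<longrightarrow>
           (\<forall>v\<in>set p. \<exists>k. real (graph_dist V E v (\<gamma> k)) \<le> R)))"

definition path_weight :: "('v set \<Rightarrow> real) \<Rightarrow> 'v list \<Rightarrow> real" where
  "path_weight \<omega> p = (\<Sum>i<path_length p. \<omega> {p ! i, p ! Suc i})"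

definition weighted_dist ::
    "'v set \<Rightarrow> 'v set set \<Rightarrow> ('v set \<Rightarrow> real) \<Rightarrow> 'v \<Rightarrow> 'v \<Rightarrow> real" where
  "weighted_dist V E \<omega> x y = (INF p\<in>{p. path_between V E x y p}. path_weight \<omega> p)"

definition weighted_geodesic ::
    "'v set \<Rightarrow> 'v set set \<Rightarrow> ('v set \<Rightarrow> real) \<Rightarrow> 'v \<Rightarrow> 'v \<Rightarrow> 'v list \<Rightarrow> bool" where
  "weighted_geodesic V E \<omega> x y p \<longleftrightarrow>
     path_between V E x y p \<and> path_weight \<omega> p = weighted_dist V E \<omega> x y"

text \<open>The list \<open>map \<gamma> [i..j]\<close> consists of \<open>\<gamma>(i), \<dots>, \<gamma>(j)\<close>: it is the subpath \<open>\<gamma>([i,j])\<close>.\<close>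

definition bi_infinite_geodesic ::
    "'v set \<Rightarrow> 'v set set \<Rightarrow> ('v set \<Rightarrow> real) \<Rightarrow> (int \<Rightarrow> 'v) \<Rightarrow> bool" where
  "bi_infinite_geodesic V E \<omega> \<gamma> \<longleftrightarrow> bi_infinite_path V E \<gamma> \<and>
     (\<forall>i j. i < j \<longrightarrow>
        path_weight \<omega> (map \<gamma> [i..j]) = weighted_dist V E \<omega> (\<gamma> i) (\<gamma> j))"

definition to_infinity_on_opposite_sides ::
    "(int \<Rightarrow> 'v) \<Rightarrow> (nat \<Rightarrow> 'v) \<Rightarrow> (nat \<Rightarrow> 'v) \<Rightarrow> bool" where
  "to_infinity_on_opposite_sides \<gamma> x y \<longleftrightarrow>
     (\<exists>s t. (\<forall>n. x n = \<gamma> (s n) \<and> y n = \<gamma> (t n)) \<and>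
        (filterlim s at_bot sequentially \<and> filterlim t at_top sequentially \<or>
         filterlim s at_top sequentially \<and> filterlim t at_bot sequentially))"

text \<open>If \<open>\<nu>\<close> lives on \<open>[0,\<infinity>)\<close>, the space of this measure is \<open>E \<rightarrow>\<^sub>E [0,\<infinity>)\<close>: configurations
  take the value \<open>undefined\<close> at arguments that are not edges, which no path uses.\<close>

definition fpp_measure :: "'v set set \<Rightarrow> real measure \<Rightarrow> ('v set \<Rightarrow> real) measure" where
  "fpp_measure E \<nu> = (\<Pi>\<^sub>M e\<in>E. \<nu>)"

end

theory Submission
  imports Defs "HOL-Library.Diagonal_Subsequence"
begin

text \<open>
  Write \<open>o = \<gamma> 0\<close>. Almost surely all geodesics of the weighted graph that join points of \<open>\<gamma>\<close> on
  opposite sides of \<open>o\<close> meet one and the same ball around \<open>o\<close> (\<open>geodesics_cross_ball\<close>). Everything else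
  follows: the ball, together with the starting points of finitely many exceptional pairs, is the
  finite set \<open>A\<close>; and geodesics from \<open>\<gamma> (- n)\<close> to \<open>\<gamma> n\<close>, which exist because long paths are heavy, cannot
  escape to infinity and accumulate at a bi-infinite geodesic (\<open>bi_infinite_geodesic_limit\<close>).

  The randomness enters only through two linear bounds. As paths of length \<open>n\<close> are exponentially
  many, exponential Markov inequalities and the Borel-Cantelli lemma show that almost surely, with
  exceptions for small \<open>n\<close>, every path of length \<open>n\<close> without repeated vertices that starts within
  distance \<open>n\<close> of \<open>o\<close> weighs between \<open>c n\<close> and \<open>b n\<close>. The lower bound uses \<open>\<nu> {0} = 0\<close>, the upper bound the
  exponential moment (\<open>linear_lower_bound\<close>, \<open>linear_upper_bound\<close>). Comparing a piece of a weighted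
  geodesic with the detour through \<open>o\<close> gives: if the geodesic stays outside a sufficiently large ball,
  whose radius depends on the configuration, then a piece with ends \<open>u\<close> and \<open>v\<close> has length at most
  \<open>B (d o u + d o v)\<close>, where \<open>B\<close> is not random (\<open>geodesic_sparse\<close>).

  What remains is a statement about the graph alone (\<open>morse_path_meets_ball\<close>): a path \<open>p\<close> satisfying
  this inequality, with its ends on \<open>\<gamma>\<close> on opposite sides of \<open>o\<close>, comes within a distance of \<open>o\<close> that
  depends only on \<open>B\<close>, the graph and \<open>\<gamma>\<close>. Let every edge of \<open>p\<close> cost \<open>1\<close> and every other edge \<open>4 B\<close>, and let \<open>q\<close> be a cheapest
  path with the ends of \<open>p\<close>. Then \<open>q\<close> is a quasi-geodesic with constant \<open>4 B\<close>, since replacing a piece by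
  a shortest path costs at most \<open>4 B\<close> times the distance. By the Morse property \<open>q\<close> stays near \<open>\<gamma>\<close>, and
  having to change from one side of \<open>o\<close> to the other, it passes near \<open>o\<close>. But an excursion of \<open>q\<close> away
  from \<open>p\<close> costs no more than following \<open>p\<close>, so it is at most a quarter of the sum of the distances of its
  ends to \<open>o\<close>, and it cannot come near \<open>o\<close> unless \<open>p\<close> does.
\<close>

section \<open>Paths in a graph\<close>

definition slice :: "'v list \<Rightarrow> nat \<Rightarrow> nat \<Rightarrow> 'v list" where
  "slice p i j = take (Suc (j - i)) (drop i p)"

lemma finite_path_length: "finite_path V E p \<Longrightarrow> length p = Suc (path_length p)"
  by (cases p) (auto simp: finite_path_def path_length_def)

lemma finite_path_nth: "finite_path V E p \<Longrightarrow> i \<le> path_length p \<Longrightarrow> p ! i \<in> V"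
  using finite_path_length[of V E p] nth_mem[of i p] unfolding finite_path_def
  by (simp add: less_Suc_eq_le subset_iff)

lemma finite_path_edge:
  "finite_path V E p \<Longrightarrow> i < path_length p \<Longrightarrow> {p ! i, p ! Suc i} \<in> E"
  by (simp add: finite_path_def path_length_def)

lemma path_between_nth:
  assumes "path_between V E x y p"
  shows "p ! 0 = x" "p ! path_length p = y"
  using assms by (auto simp: path_between_def finite_path_def path_length_def hd_conv_nth last_conv_nth)

lemma path_between_in_V:
  assumes "path_between V E x y p"
  shows "x \<in> V" "y \<in> V"
  using assms by (auto simp: path_between_def finite_path_def)

lemma in_set_path_nth:
  assumes "finite_path V E p" "v \<in> set p"
  obtains i where "i \<le> path_length p" "p ! i = v"
  using assms finite_path_length[OF assms(1)] by (metis in_set_conv_nth less_Suc_eq_le)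

lemma slice_length:
  assumes "finite_path V E p" "i \<le> j" "j \<le> path_length p"
  shows "path_length (slice p i j) = j - i" "length (slice p i j) = Suc (j - i)"
proof -
  show "length (slice p i j) = Suc (j - i)"
    using assms finite_path_length[OF assms(1)] by (simp add: slice_def)
  then show "path_length (slice p i j) = j - i" by (simp add: path_length_def)
qed

lemma slice_nth:
  assumes "finite_path V E p" "i \<le> j" "j \<le> path_length p" "k \<le> j - i"
  shows "slice p i j ! k = p ! (i + k)"
  using assms finite_path_length[OF assms(1)] by (auto simp: slice_def)

lemma set_slice: "set (slice p i j) \<subseteq> set p"
  by (auto simp: slice_def dest: in_set_takeD in_set_dropD)

lemma distinct_slice: "distinct p \<Longrightarrow> distinct (slice p i j)"
  by (simp add: slice_def)

lemma path_between_slice: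
  assumes "finite_path V E p" "i \<le> j" "j \<le> path_length p"
  shows "path_between V E (p ! i) (p ! j) (slice p i j)"
proof -
  note len = slice_length[OF assms]
  have ne: "slice p i j \<noteq> []" using len by auto
  have "finite_path V E (slice p i j)"
    unfolding finite_path_def
  proof (intro conjI allI impI)
    show "set (slice p i j) \<subseteq> V"
      using set_slice[of p i j] assms(1) by (auto simp: finite_path_def)
    fix k assume "Suc k < length (slice p i j)"
    then have "Suc k \<le> j - i" using len by simp
    then show "{slice p i j ! k, slice p i j ! Suc k} \<in> E"
      using slice_nth[OF assms, of k] slice_nth[OF assms, of "Suc k"]
        finite_path_edge[OF assms(1), of "i + k"] assms by auto
  qed (rule ne)
  moreover have "hd (slice p i j) = p ! i"
    using slice_nth[OF assms, of 0] ne by (simp add: hd_conv_nth)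
  moreover have "last (slice p i j) = p ! j"
    using slice_nth[OF assms, of "j - i"] ne len assms by (simp add: last_conv_nth)
  ultimately show ?thesis by (simp add: path_between_def)
qed

lemma path_weight_slice:
  assumes "finite_path V E p" "i \<le> j" "j \<le> path_length p"
  shows "path_weight \<omega> (slice p i j) = (\<Sum>k=i..<j. \<omega> {p ! k, p ! Suc k})"
proof -
  have "path_weight \<omega> (slice p i j) = (\<Sum>k<j - i. \<omega> {p ! (i + k), p ! Suc (i + k)})"
    unfolding path_weight_def slice_length[OF assms]
    by (intro sum.cong refl) (simp add: slice_nth[OF assms])
  also have "\<dots> = (\<Sum>k=i..<j. \<omega> {p ! k, p ! Suc k})"
    using assms(2) by (intro sum.reindex_bij_witness[of _ "\<lambda>k. k - i" "\<lambda>k. i + k"]) auto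
  finally show ?thesis .
qed

lemma path_weight_split:
  assumes "finite_path V E p" "i \<le> j" "j \<le> path_length p"
  shows "path_weight \<omega> p = path_weight \<omega> (slice p 0 i) + path_weight \<omega> (slice p i j)
           + path_weight \<omega> (slice p j (path_length p))"
proof -
  have "path_weight \<omega> p = (\<Sum>k=0..<path_length p. \<omega> {p ! k, p ! Suc k})"
    by (simp add: path_weight_def atLeast0LessThan)
  then show ?thesis
    using assms sum.atLeastLessThan_concat[of 0 i j "\<lambda>k. \<omega> {p ! k, p ! Suc k}"]
      sum.atLeastLessThan_concat[of 0 j "path_length p" "\<lambda>k. \<omega> {p ! k, p ! Suc k}"]
    by (simp add: path_weight_slice[OF assms(1)])
qed

definition path_join :: "'v list \<Rightarrow> 'v list \<Rightarrow> 'v list" where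
  "path_join p q = p @ tl q"

lemma path_join_nth:
  assumes "path_between V E x y p" "path_between V E y z q"
  shows "k \<le> path_length p \<Longrightarrow> path_join p q ! k = p ! k"
    and "k \<le> path_length q \<Longrightarrow> path_join p q ! (path_length p + k) = q ! k"
proof -
  have p: "finite_path V E p" and q: "finite_path V E q"
    using assms by (auto simp: path_between_def)
  note l = finite_path_length[OF p] finite_path_length[OF q]
  show 1: "k \<le> path_length p \<Longrightarrow> path_join p q ! k = p ! k" for k
    using l by (simp add: path_join_def nth_append)
  show "k \<le> path_length q \<Longrightarrow> path_join p q ! (path_length p + k) = q ! k"
    using 1[of "path_length p"] path_between_nth[OF assms(1)] path_between_nth[OF assms(2)] l
    by (cases k) (auto simp: path_join_def nth_append nth_tl)
qed

lemma path_between_join: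
  assumes "path_between V E x y p" "path_between V E y z q"
  shows "path_between V E x z (path_join p q)"
    and "path_length (path_join p q) = path_length p + path_length q"
    and "path_weight \<omega> (path_join p q) = path_weight \<omega> p + path_weight \<omega> q"
proof -
  have p: "finite_path V E p" and q: "finite_path V E q"
    using assms by (auto simp: path_between_def)
  note l = finite_path_length[OF p] finite_path_length[OF q]
  note n = path_join_nth[OF assms]
  show len: "path_length (path_join p q) = path_length p + path_length q"
    using l unfolding path_length_def[of "path_join p q"] by (simp add: path_join_def)
  have ne: "path_join p q \<noteq> []" using l by (auto simp: path_join_def)
  have edge: "{path_join p q ! k, path_join p q ! Suc k} \<in> E"
    if k: "k < path_length p + path_length q" for k
  proof (cases "k < path_length p")
    case True
    then show ?thesis using n(1)[of k] n(1)[of "Suc k"] finite_path_edge[OF p] by simp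
  next
    case False
    then obtain m where "k = path_length p + m" "m < path_length q"
      using k by (metis add_less_cancel_left le_Suc_ex not_less)
    then show ?thesis using n(2)[of m] n(2)[of "Suc m"] finite_path_edge[OF q, of m] by simp
  qed
  have "set (path_join p q) \<subseteq> V"
    using p q by (auto simp: path_join_def finite_path_def dest: list.set_sel(2))
  then have "finite_path V E (path_join p q)"
    using ne edge len by (auto simp: finite_path_def path_length_def)
  moreover have "hd (path_join p q) = x"
    using n(1)[of 0] ne path_between_nth[OF assms(1)] by (simp add: hd_conv_nth)
  moreover have "last (path_join p q) = z"
    using n(2)[of "path_length q"] ne path_between_nth[OF assms(2)] len
    by (simp add: last_conv_nth path_length_def)
  ultimately show "path_between V E x z (path_join p q)" by (simp add: path_between_def)
  have "path_weight \<omega> (path_join p q) =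
      (\<Sum>k=0..<path_length p. \<omega> {path_join p q ! k, path_join p q ! Suc k})
      + (\<Sum>k=path_length p..<path_length p + path_length q.
          \<omega> {path_join p q ! k, path_join p q ! Suc k})"
    by (simp add: path_weight_def len sum.atLeastLessThan_concat flip: atLeast0LessThan)
  also have "(\<Sum>k=0..<path_length p. \<omega> {path_join p q ! k, path_join p q ! Suc k}) = path_weight \<omega> p"
    unfolding path_weight_def by (intro sum.cong) (auto simp: n(1))
  also have "(\<Sum>k=path_length p..<path_length p + path_length q.
          \<omega> {path_join p q ! k, path_join p q ! Suc k}) = path_weight \<omega> q"
    unfolding path_weight_def
  proof (rule sum.reindex_bij_witness[of _ "\<lambda>k. path_length p + k" "\<lambda>k. k - path_length p"])
    fix k assume "k \<in> {path_length p..<path_length p + path_length q}"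
    then obtain m where "k = path_length p + m" "m < path_length q"
      by (metis add_less_cancel_left atLeastLessThan_iff le_Suc_ex)
    then show "\<omega> {q ! (k - path_length p), q ! Suc (k - path_length p)}
        = \<omega> {path_join p q ! k, path_join p q ! Suc k}"
      using n(2)[of m] n(2)[of "Suc m"] by simp
  qed auto
  finally show "path_weight \<omega> (path_join p q) = path_weight \<omega> p + path_weight \<omega> q" .
qed

lemma path_between_rev:
  assumes "path_between V E x y p"
  shows "path_between V E y x (rev p)"
    and "path_length (rev p) = path_length p"
    and "path_weight \<omega> (rev p) = path_weight \<omega> p"
proof -
  have p: "finite_path V E p" using assms by (auto simp: path_between_def)
  note l = finite_path_length[OF p]
  show len: "path_length (rev p) = path_length p" by (simp add: path_length_def)
  have nth: "rev p ! k = p ! (path_length p - k)" if "k \<le> path_length p" for k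
    using that l by (simp add: rev_nth)
  have flip: "{rev p ! k, rev p ! Suc k} = {p ! (path_length p - Suc k), p ! Suc (path_length p - Suc k)}"
    if "k < path_length p" for k
    using that nth[of k] nth[of "Suc k"] by (auto simp: Suc_diff_Suc insert_commute)
  show "path_between V E y x (rev p)"
    using assms flip finite_path_edge[OF p]
    by (auto simp: path_between_def finite_path_def path_length_def hd_rev last_rev)
  show "path_weight \<omega> (rev p) = path_weight \<omega> p"
    unfolding path_weight_def len
    by (intro sum.reindex_bij_witness[of _ "\<lambda>k. path_length p - Suc k" "\<lambda>k. path_length p - Suc k"])
       (auto simp: flip)
qed

lemma path_weight_nonneg:
  assumes "finite_path V E p" "\<forall>e\<in>E. 0 \<le> \<omega> e"
  shows "0 \<le> path_weight \<omega> p"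
  using assms finite_path_edge[OF assms(1)] by (auto simp: path_weight_def intro!: sum_nonneg)

lemma path_between_cut:
  assumes "path_between V E x y p" "i < j" "j \<le> path_length p" "p ! i = p ! j"
  obtains q where "path_between V E x y q"
    "path_length q < path_length p"
    "\<And>\<omega>. path_weight \<omega> q = path_weight \<omega> p - path_weight \<omega> (slice p i j)"
proof -
  have p: "finite_path V E p" using assms by (auto simp: path_between_def)
  note n = path_between_nth[OF assms(1)]
  have 1: "path_between V E x (p ! j) (slice p 0 i)"
    using path_between_slice[OF p, of 0 i] assms n by simp
  have 2: "path_between V E (p ! j) y (slice p j (path_length p))"
    using path_between_slice[OF p, of j "path_length p"] assms n by simp
  let ?q = "path_join (slice p 0 i) (slice p j (path_length p))"
  note b = path_between_join[OF 1 2]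
  show ?thesis
    using b(1) b(2) b(3) assms path_weight_split[OF p, of i j]
      slice_length[OF p, of 0 i] slice_length[OF p, of j "path_length p"]
    by (intro that[of ?q]) auto
qed

text \<open>Cutting out a loop does not increase the weight and decreases the length, so it can be repeated
  until no vertex is visited twice. Only then are the weights along the path independent.\<close>

lemma distinct_path_exists:
  assumes "path_between V E x y p" "\<forall>e\<in>E. 0 \<le> \<omega> e"
  shows "\<exists>q. path_between V E x y q \<and> distinct q \<and> path_weight \<omega> q \<le> path_weight \<omega> p
           \<and> path_length q \<le> path_length p"
  using assms(1)
proof (induction "path_length p" arbitrary: p rule: less_induct)
  case less
  have p: "finite_path V E p" using less by (auto simp: path_between_def)
  show ?case
  proof (cases "distinct p")
    case False
    then obtain i j where ij: "i < j" "j \<le> path_length p" "p ! i = p ! j"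
      using finite_path_length[OF p] by (metis distinct_conv_nth less_Suc_eq_le nat_neq_iff)
    obtain q where q: "path_between V E x y q" "path_length q < path_length p"
      "path_weight \<omega> q = path_weight \<omega> p - path_weight \<omega> (slice p i j)"
      using path_between_cut[OF less.prems ij] by metis
    have "0 \<le> path_weight \<omega> (slice p i j)"
      using path_between_slice[OF p, of i j] ij assms(2) path_weight_nonneg
      by (metis less_imp_le path_between_def)
    then show ?thesis using less.hyps[OF q(2,1)] q(2,3) by fastforce
  qed (use less in auto)
qed

section \<open>Weighted distances and geodesics\<close>

lemma weighted_dist_le:
  assumes "path_between V E x y p" "\<forall>e\<in>E. 0 \<le> \<omega> e"
  shows "weighted_dist V E \<omega> x y \<le> path_weight \<omega> p"
  unfolding weighted_dist_def
proof (rule cINF_lower)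
  show "bdd_below (path_weight \<omega> ` {p. path_between V E x y p})"
    using path_weight_nonneg assms(2) by (intro bdd_belowI[of _ 0]) (auto simp: path_between_def)
qed (use assms in simp)

lemma weighted_geodesicI:
  assumes "path_between V E x y p" "\<forall>e\<in>E. 0 \<le> \<omega> e"
    "\<And>q. path_between V E x y q \<Longrightarrow> path_weight \<omega> p \<le> path_weight \<omega> q"
  shows "weighted_geodesic V E \<omega> x y p"
proof -
  have "path_weight \<omega> p \<le> weighted_dist V E \<omega> x y"
    unfolding weighted_dist_def using assms by (intro cINF_greatest) auto
  then show ?thesis
    using weighted_dist_le[OF assms(1,2)] assms(1) by (simp add: weighted_geodesic_def)
qed

lemma weighted_geodesic_le:
  assumes "weighted_geodesic V E \<omega> x y p" "\<forall>e\<in>E. 0 \<le> \<omega> e" "path_between V E x y q"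
  shows "path_weight \<omega> p \<le> path_weight \<omega> q"
  using weighted_dist_le[OF assms(3,2)] assms(1) by (simp add: weighted_geodesic_def)

text \<open>A cheaper way between two vertices of a geodesic could be spliced into it.\<close>

lemma weighted_geodesic_slice:
  assumes "weighted_geodesic V E \<omega> x y p" "\<forall>e\<in>E. 0 \<le> \<omega> e" "i \<le> j" "j \<le> path_length p"
  shows "weighted_geodesic V E \<omega> (p ! i) (p ! j) (slice p i j)"
proof -
  have pb: "path_between V E x y p" using assms by (simp add: weighted_geodesic_def)
  then have p: "finite_path V E p" by (simp add: path_between_def)
  note n = path_between_nth[OF pb]
  show ?thesis
  proof (rule weighted_geodesicI)
    show "path_between V E (p ! i) (p ! j) (slice p i j)"
      using path_between_slice[OF p] assms by simp
    fix q assume q: "path_between V E (p ! i) (p ! j) q"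
    have 1: "path_between V E x (p ! i) (slice p 0 i)"
      using path_between_slice[OF p, of 0 i] assms n by simp
    have 2: "path_between V E (p ! j) y (slice p j (path_length p))"
      using path_between_slice[OF p, of j "path_length p"] assms n by simp
    have "path_weight \<omega> p \<le> path_weight \<omega> (path_join (path_join (slice p 0 i) q) (slice p j (path_length p)))"
      using path_between_join(1)[OF path_between_join(1)[OF 1 q] 2] assms weighted_geodesic_le by metis
    then show "path_weight \<omega> (slice p i j) \<le> path_weight \<omega> q"
      using path_between_join(3)[OF path_between_join(1)[OF 1 q] 2] path_between_join(3)[OF 1 q]
        path_weight_split[OF p assms(3,4), of \<omega>] by simp
  qed (rule assms(2))
qed

text \<open>A loop has positive weight, so cutting it out would give a cheaper path. This is what makes the
  estimates for paths without repeated vertices available for every geodesic.\<close>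

lemma weighted_geodesic_distinct:
  assumes "weighted_geodesic V E \<omega> x y p" "\<forall>e\<in>E. 0 < \<omega> e"
  shows "distinct p"
proof (rule ccontr)
  have nonneg: "\<forall>e\<in>E. 0 \<le> \<omega> e" using assms(2) by (auto intro: less_imp_le)
  have pb: "path_between V E x y p" using assms by (simp add: weighted_geodesic_def)
  then have p: "finite_path V E p" by (simp add: path_between_def)
  assume "\<not> distinct p"
  then obtain i j where ij: "i < j" "j \<le> path_length p" "p ! i = p ! j"
    using finite_path_length[OF p] by (metis distinct_conv_nth less_Suc_eq_le nat_neq_iff)
  obtain q where q: "path_between V E x y q"
    "path_weight \<omega> q = path_weight \<omega> p - path_weight \<omega> (slice p i j)"
    using path_between_cut[OF pb ij] by metis
  have "0 < path_weight \<omega> (slice p i j)"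
    unfolding path_weight_slice[OF p less_imp_le[OF ij(1)] ij(2)]
    using ij assms(2) finite_path_edge[OF p] by (intro sum_pos) auto
  then show False using weighted_geodesic_le[OF assms(1) nonneg q(1)] q(2) by simp
qed

section \<open>The graph metric\<close>

text \<open>The bound \<open>D\<close> is taken to be at least one so that \<open>D ^ n\<close> is monotone in \<open>n\<close>.\<close>

locale bounded_degree_graph =
  fixes V :: "'v set" and E :: "'v set set" and D :: nat
  assumes simple: "simple_graph V E"
    and connected: "connected_graph V E"
    and finite_degree: "v \<in> V \<Longrightarrow> finite {e\<in>E. v \<in> e}"
    and degree: "v \<in> V \<Longrightarrow> card {e\<in>E. v \<in> e} \<le> D"
    and D_pos: "1 \<le> D"
begin

abbreviation dist_g :: "'v \<Rightarrow> 'v \<Rightarrow> nat" where "dist_g \<equiv> graph_dist V E"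

lemma dist_path:
  assumes "x \<in> V" "y \<in> V"
  obtains p where "path_between V E x y p" "path_length p = dist_g x y"
proof -
  have "dist_g x y \<in> path_length ` {p. path_between V E x y p}"
    unfolding graph_dist_def using assms connected
    by (intro Inf_nat_def1) (auto simp: connected_graph_def)
  then show ?thesis using that by auto
qed

lemma dist_le_length: "path_between V E x y p \<Longrightarrow> dist_g x y \<le> path_length p"
  unfolding graph_dist_def by (intro cINF_lower) auto

lemma dist_le_diff:
  assumes "finite_path V E p" "i \<le> j" "j \<le> path_length p"
  shows "dist_g (p ! i) (p ! j) \<le> j - i"
  using dist_le_length[OF path_between_slice[OF assms]] slice_length[OF assms] by simp

lemma dist_commute:
  assumes "x \<in> V" "y \<in> V" shows "dist_g x y = dist_g y x"
proof -
  have "dist_g x y \<le> dist_g y x" if "x \<in> V" "y \<in> V" for x y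
    using dist_path[OF that(2,1)] dist_le_length path_between_rev(1,2) by metis
  then show ?thesis using assms by (simp add: le_antisym)
qed

lemma dist_triangle:
  assumes "x \<in> V" "y \<in> V" "z \<in> V"
  shows "dist_g x z \<le> dist_g x y + dist_g y z"
  using dist_path[OF assms(1,2)] dist_path[OF assms(2,3)] dist_le_length path_between_join(1,2)
  by metis

lemma path_between_singleton: "x \<in> V \<Longrightarrow> path_between V E x x [x]"
  by (simp add: path_between_def finite_path_def)

lemma dist_self: "x \<in> V \<Longrightarrow> dist_g x x = 0"
  using dist_le_length[OF path_between_singleton] by (simp add: path_length_def)

lemma edge_verts: "{a, b} \<in> E \<Longrightarrow> a \<in> V \<and> b \<in> V"
  using simple by (auto simp: simple_graph_def)

lemma path_between_edge: "{a, b} \<in> E \<Longrightarrow> path_between V E a b [a, b]"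
  using edge_verts by (auto simp: path_between_def finite_path_def nth_Cons')

lemma bi_infinite_dist_le:
  assumes "bi_infinite_path V E g" "i \<le> j"
  shows "int (dist_g (g i) (g j)) \<le> j - i"
proof -
  have "dist_g (g i) (g (i + int n)) \<le> n" for n
  proof (induction n)
    case 0
    then show ?case using assms by (simp add: bi_infinite_path_def dist_self)
  next
    case (Suc n)
    have e: "{g (i + int n), g (i + int (Suc n))} \<in> E"
      using assms(1)[unfolded bi_infinite_path_def, rule_format, of "i + int n"]
      by (simp add: algebra_simps)
    have "dist_g (g (i + int n)) (g (i + int (Suc n))) \<le> 1"
      using dist_le_length[OF path_between_edge[OF e]] by (simp add: path_length_def)
    then show ?case
      using dist_triangle[of "g i" "g (i + int n)" "g (i + int (Suc n))"] Suc assms(1)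
      by (auto simp: bi_infinite_path_def)
  qed
  from this[of "nat (j - i)"] show ?thesis using assms(2) by simp
qed

section \<open>The number of paths\<close>

definition paths_from :: "'v \<Rightarrow> nat \<Rightarrow> 'v list set" where
  "paths_from x n = {p. finite_path V E p \<and> hd p = x \<and> path_length p = n}"

lemma neighbours:
  assumes "u \<in> V"
  shows "finite {v. {u, v} \<in> E}" "card {v. {u, v} \<in> E} \<le> D"
proof -
  have inj: "inj_on (\<lambda>v. {u, v}) {v. {u, v} \<in> E}" by (auto simp: inj_on_def doubleton_eq_iff)
  have sub: "(\<lambda>v. {u, v}) ` {v. {u, v} \<in> E} \<subseteq> {e\<in>E. u \<in> e}" by auto
  show "finite {v. {u, v} \<in> E}"
    using inj sub finite_degree[OF assms] by (meson finite_imageD finite_subset)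
  show "card {v. {u, v} \<in> E} \<le> D"
    using card_inj_on_le[OF inj sub finite_degree[OF assms]] degree[OF assms] by simp
qed

lemma paths_from_Suc:
  "paths_from x (Suc n) \<subseteq> (\<lambda>(p, v). p @ [v]) ` (SIGMA p:paths_from x n. {v. {last p, v} \<in> E})"
proof
  fix p assume "p \<in> paths_from x (Suc n)"
  then have p: "finite_path V E p" "hd p = x" "path_length p = Suc n" by (auto simp: paths_from_def)
  have l: "length p = Suc (Suc n)" using finite_path_length[OF p(1)] p(3) by simp
  then have ne: "p \<noteq> []" by auto
  have sub: "butlast p = slice p 0 n" using l by (simp add: slice_def butlast_conv_take)
  have "butlast p \<in> paths_from x n"
    using path_between_slice[OF p(1), of 0 n] slice_length[OF p(1), of 0 n] p hd_conv_nth[OF ne]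
    by (auto simp: paths_from_def sub path_between_def)
  moreover have "last (butlast p) = p ! n"
    using path_between_slice[OF p(1), of 0 n] p by (simp add: sub path_between_def)
  moreover have "last p = p ! Suc n" using l by (subst last_conv_nth) auto
  moreover have "p = butlast p @ [last p]" using ne by simp
  ultimately show "p \<in> (\<lambda>(p, v). p @ [v]) ` (SIGMA p:paths_from x n. {v. {last p, v} \<in> E})"
    using finite_path_edge[OF p(1), of n] p(3)
    by (intro image_eqI[of _ _ "(butlast p, last p)"]) auto
qed

lemma paths_from_count:
  assumes "x \<in> V"
  shows "finite (paths_from x n) \<and> card (paths_from x n) \<le> D ^ n"
proof (induction n)
  case 0
  have "paths_from x 0 \<subseteq> {[x]}"
    by (auto simp: paths_from_def path_length_def finite_path_def length_Suc_conv
          dest!: length_0_conv[THEN iffD1] simp: le_Suc_eq)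
  then show ?case
    using finite_subset card_mono[of "{[x]}" "paths_from x 0"] by fastforce
next
  case (Suc n)
  let ?S = "SIGMA p:paths_from x n. {v. {last p, v} \<in> E}"
  have lastV: "last p \<in> V" if "p \<in> paths_from x n" for p
    using that by (auto simp: paths_from_def finite_path_def)
  have fin: "finite ?S" using Suc neighbours lastV by (intro finite_SigmaI) auto
  have "card ?S = (\<Sum>p\<in>paths_from x n. card {v. {last p, v} \<in> E})"
    using Suc neighbours lastV by (intro card_SigmaI) auto
  also have "\<dots> \<le> of_nat (card (paths_from x n)) * D"
    using neighbours lastV by (intro sum_bounded_above) auto
  also have "\<dots> \<le> D ^ Suc n" using Suc by simp
  finally have "card ?S \<le> D ^ Suc n" .
  moreover have "card (paths_from x (Suc n)) \<le> card ?S"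
    using surj_card_le[OF fin paths_from_Suc] .
  ultimately show ?case using finite_subset[OF paths_from_Suc] fin by (meson finite_imageI le_trans)
qed

lemma finite_ball:
  assumes "x \<in> V"
  shows "finite {v\<in>V. dist_g x v \<le> n}"
proof (rule finite_subset)
  show "{v\<in>V. dist_g x v \<le> n} \<subseteq> last ` (\<Union>k\<le>n. paths_from x k)"
  proof
    fix v assume v: "v \<in> {v\<in>V. dist_g x v \<le> n}"
    then obtain p where "path_between V E x v p" "path_length p = dist_g x v"
      using dist_path[of x v] assms by auto
    then show "v \<in> last ` (\<Union>k\<le>n. paths_from x k)"
      using v by (intro image_eqI[of _ _ p]) (auto simp: paths_from_def path_between_def)
  qed
qed (use paths_from_count[OF assms] in auto)

lemma countable_verts: "countable V"
proof (cases "V = {}")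
  case False
  then obtain x where x: "x \<in> V" by auto
  have "V \<subseteq> (\<Union>n. {v\<in>V. dist_g x v \<le> n})" by auto
  then show ?thesis
    using finite_ball[OF x] by (meson countable_UN countable_finite countable_subset countableI_type)
qed simp

lemma countable_edges: "countable E"
proof (rule countable_subset)
  show "E \<subseteq> (\<lambda>(a, b). {a, b}) ` (V \<times> V)"
  proof
    fix e assume e: "e \<in> E"
    then obtain a b where "e = {a, b}"
      using simple by (auto simp: simple_graph_def card_2_iff)
    then show "e \<in> (\<lambda>(a, b). {a, b}) ` (V \<times> V)" using edge_verts e by auto
  qed
qed (use countable_verts in auto)

text \<open>The family over which the union bounds are taken. The start is free within distance \<open>n\<close> of
  \<open>x\<close>, because the estimates are applied to pieces of geodesics that may lie far away from \<open>x\<close>. A piece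
  with fewer edges than the distance from its start to \<open>x\<close> is short enough for the purpose at hand
  already, so no larger family is needed, and this one still grows only exponentially.\<close>

definition near_paths :: "'v \<Rightarrow> nat \<Rightarrow> 'v list set" where
  "near_paths x n =
     {p. finite_path V E p \<and> distinct p \<and> path_length p = n \<and> dist_g x (hd p) \<le> n}"

text \<open>A path of length \<open>n\<close> starting at distance \<open>k\<close> from \<open>x\<close> is the end piece of a path of length
  \<open>k + n\<close> starting at \<open>x\<close>, of which there are at most \<open>D ^ (k + n)\<close>; and \<open>n + 1 \<le> 2 ^ n\<close> accounts for the
  choice of \<open>k \<le> n\<close>.\<close>

lemma near_paths_count:
  assumes "x \<in> V"
  shows "finite (near_paths x n)" "card (near_paths x n) \<le> (2 * D\<^sup>2) ^ n"
proof -
  let ?U = "\<Union>k\<le>n. drop k ` paths_from x (k + n)"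
  have sub: "near_paths x n \<subseteq> ?U"
  proof
    fix p assume "p \<in> near_paths x n"
    then have p: "finite_path V E p" "path_length p = n" "dist_g x (hd p) \<le> n"
      by (auto simp: near_paths_def)
    then have "hd p \<in> V" by (auto simp: finite_path_def)
    then obtain q where q: "path_between V E x (hd p) q" "path_length q = dist_g x (hd p)"
      using dist_path[OF assms] by metis
    have pb: "path_between V E (hd p) (last p) p" using p by (simp add: path_between_def)
    note j = path_between_join[OF q(1) pb]
    have fq: "finite_path V E q" "q \<noteq> []" "last q = hd p" "p \<noteq> []"
      using q p by (auto simp: path_between_def finite_path_def)
    have "path_join q p = butlast q @ p"
      unfolding path_join_def using fq(2,3,4)
      by (metis append_butlast_last_id append_assoc append_Cons append_Nil list.collapse)
    then have "drop (path_length q) (path_join q p) = p"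
      using finite_path_length[OF fq(1)] by simp
    moreover have "path_join q p \<in> paths_from x (path_length q + n)"
      using j(1,2) p by (auto simp: paths_from_def path_between_def)
    ultimately show "p \<in> ?U" using q p by (auto intro!: bexI[of _ "path_length q"] image_eqI[of p _ "path_join q p"])
  qed
  have fin: "finite ?U" using paths_from_count[OF assms] by auto
  then show "finite (near_paths x n)" using sub finite_subset by blast
  have "card (near_paths x n) \<le> card ?U" using card_mono[OF fin sub] .
  also have "\<dots> \<le> (\<Sum>k\<le>n. card (drop k ` paths_from x (k + n)))" by (rule card_UN_le) simp
  also have "\<dots> \<le> (\<Sum>k\<le>n. D ^ (2 * n))"
  proof (rule sum_mono)
    fix k assume "k \<in> {..n}"
    then have "D ^ (k + n) \<le> D ^ (2 * n)" using D_pos by (intro power_increasing) auto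
    then show "card (drop k ` paths_from x (k + n)) \<le> D ^ (2 * n)"
      using paths_from_count[OF assms, of "k + n"]
        card_image_le[of "paths_from x (k + n)" "drop k"] by linarith
  qed
  also have "\<dots> = Suc n * D ^ (2 * n)" by simp
  also have "\<dots> \<le> 2 ^ n * D ^ (2 * n)"
    by (intro mult_right_mono) (simp_all add: Suc_leI)
  also have "\<dots> = (2 * D\<^sup>2) ^ n" by (simp add: power_mult_distrib power_mult)
  finally show "card (near_paths x n) \<le> (2 * D\<^sup>2) ^ n" .
qed

section \<open>Existence of weighted geodesics\<close>

text \<open>If long paths without repeated vertices are heavy, then only the finitely many paths up to some
  length compete for the minimum. Arbitrary long paths need not be heavy, as they may run back and
  forth over an edge of tiny weight.\<close>

lemma weighted_geodesic_exists:
  assumes "x \<in> V" "y \<in> V" and nonneg: "\<forall>e\<in>E. 0 \<le> \<omega> e"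
    and proper: "\<And>M. \<exists>N. \<forall>p. finite_path V E p \<and> distinct p \<and> hd p = x \<and> N \<le> path_length p
                   \<longrightarrow> M \<le> path_weight \<omega> p"
  obtains p where "weighted_geodesic V E \<omega> x y p"
proof -
  obtain p0 where p0: "path_between V E x y p0"
    using dist_path[OF assms(1,2)] by blast
  obtain N where N: "\<And>p. finite_path V E p \<Longrightarrow> distinct p \<Longrightarrow> hd p = x \<Longrightarrow> N \<le> path_length p
      \<Longrightarrow> path_weight \<omega> p0 \<le> path_weight \<omega> p"
    using proper[of "path_weight \<omega> p0"] by blast
  let ?S = "insert p0 {p. path_between V E x y p \<and> path_length p \<le> N}"
  have "?S \<subseteq> insert p0 (\<Union>k\<le>N. paths_from x k)"
    by (auto simp: paths_from_def path_between_def)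
  then have fin: "finite ?S"
    by (rule finite_subset) (simp add: paths_from_count[OF assms(1)])
  have "Min (path_weight \<omega> ` ?S) \<in> path_weight \<omega> ` ?S"
    by (rule Min_in) (use fin in simp_all)
  then obtain p where p: "p \<in> ?S" "Min (path_weight \<omega> ` ?S) = path_weight \<omega> p" by (rule imageE)
  have p_min: "path_weight \<omega> p \<le> path_weight \<omega> q" if "q \<in> ?S" for q
    unfolding p(2)[symmetric] by (rule Min_le[OF finite_imageI[OF fin] imageI[OF that]])
  have "weighted_geodesic V E \<omega> x y p"
  proof (rule weighted_geodesicI[OF _ nonneg])
    show "path_between V E x y p" using p(1) p0 by auto
    fix q assume q: "path_between V E x y q"
    obtain r where r: "path_between V E x y r" "distinct r" "path_weight \<omega> r \<le> path_weight \<omega> q"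
      using distinct_path_exists[OF q nonneg] by blast
    have "path_weight \<omega> p \<le> path_weight \<omega> r"
    proof (cases "path_length r \<le> N")
      case False
      then show ?thesis using N[of r] r p_min[of p0] by (auto simp: path_between_def)
    qed (use p_min[of r] r in auto)
    then show "path_weight \<omega> p \<le> path_weight \<omega> q" using r by simp
  qed
  then show ?thesis using that by blast
qed

section \<open>Replacing a path by a quasi-geodesic\<close>

text \<open>For the weights that charge \<open>1\<close> on the edges of a given path \<open>p\<close> and \<open>C\<close> elsewhere, a geodesic
  with the ends of \<open>p\<close> is a compromise between \<open>p\<close> and the graph metric: the bound \<open>C\<close> forces it to be a
  quasi-geodesic, and the discount on \<open>p\<close> keeps it from taking shortcuts that do not pay.\<close>

definition tame_weight :: "real \<Rightarrow> 'v list \<Rightarrow> 'v set \<Rightarrow> real" where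
  "tame_weight C p e = (if \<exists>i<path_length p. e = {p ! i, p ! Suc i} then 1 else C)"

lemma tame_weight_on: "i < path_length p \<Longrightarrow> tame_weight C p {p ! i, p ! Suc i} = 1"
  unfolding tame_weight_def by (rule if_P) blast

lemma tame_weight_bounds:
  assumes "1 \<le> C"
  shows "1 \<le> tame_weight C p e" "tame_weight C p e \<le> C"
  using assms by (auto simp: tame_weight_def)

lemma length_le_tame_weight:
  assumes "1 \<le> C"
  shows "real (path_length q) \<le> path_weight (tame_weight C p) q"
    and "path_weight (tame_weight C p) q \<le> C * real (path_length q)"
proof -
  have "(\<Sum>i<path_length q. 1::real) \<le> path_weight (tame_weight C p) q"
    unfolding path_weight_def by (intro sum_mono tame_weight_bounds assms)
  then show "real (path_length q) \<le> path_weight (tame_weight C p) q" by simp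
  have "path_weight (tame_weight C p) q \<le> (\<Sum>i<path_length q. C)"
    unfolding path_weight_def by (intro sum_mono tame_weight_bounds assms)
  then show "path_weight (tame_weight C p) q \<le> C * real (path_length q)" by (simp add: mult.commute)
qed

lemma tame_geodesic_exists:
  assumes "1 \<le> C" "x \<in> V" "y \<in> V"
  obtains q where "weighted_geodesic V E (tame_weight C p) x y q"
proof (rule weighted_geodesic_exists[OF assms(2,3)])
  show "\<forall>e\<in>E. 0 \<le> tame_weight C p e" using tame_weight_bounds(1)[OF assms(1)] by (meson order_trans zero_le_one)
  fix M :: real
  show "\<exists>N. \<forall>q. finite_path V E q \<and> distinct q \<and> hd q = x \<and> N \<le> path_length q
          \<longrightarrow> M \<le> path_weight (tame_weight C p) q"
  proof -
    obtain N :: nat where "M \<le> real N" using real_arch_simple by blast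
    then have "M \<le> path_weight (tame_weight C p) q" if "N \<le> path_length q" for q
      using that length_le_tame_weight(1)[OF assms(1), of q p] by linarith
    then show ?thesis by blast
  qed
qed (use that in blast)

text \<open>The length of a piece is at most its weight, hence at most the weight of a shortest path between
  the same vertices, which is at most \<open>C\<close> times their distance.\<close>

lemma tame_geodesic_quasi_geodesic:
  assumes "1 \<le> C" "0 \<le> K" "weighted_geodesic V E (tame_weight C p) x y q"
  shows "quasi_geodesic_finite V E C K q"
  unfolding quasi_geodesic_finite_def
proof (intro conjI allI impI)
  have nonneg: "\<forall>e\<in>E. 0 \<le> tame_weight C p e"
    using tame_weight_bounds(1)[OF assms(1)] by (meson order_trans zero_le_one)
  show q: "finite_path V E q" using assms by (simp add: weighted_geodesic_def path_between_def)
  fix i j assume ij: "i < j \<and> j \<le> path_length q"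
  then have in_V: "q ! i \<in> V" "q ! j \<in> V" using finite_path_nth[OF q] by auto
  obtain r where r: "path_between V E (q ! i) (q ! j) r" "path_length r = graph_dist V E (q ! i) (q ! j)"
    using dist_path[OF in_V] by metis
  have "real (j - i) = path_length (slice q i j)" using slice_length[OF q, of i j] ij by simp
  also have "\<dots> \<le> path_weight (tame_weight C p) (slice q i j)"
    by (rule length_le_tame_weight[OF assms(1)])
  also have "\<dots> \<le> path_weight (tame_weight C p) r"
    using weighted_geodesic_le[OF weighted_geodesic_slice[OF assms(3) nonneg] nonneg r(1)] ij by simp
  also have "\<dots> \<le> C * graph_dist V E (q ! i) (q ! j)"
    using length_le_tame_weight(2)[OF assms(1)] r(2) by metis
  finally show "real (j - i) \<le> C * real (graph_dist V E (q ! i) (q ! j)) + K" using assms(2) by simp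
qed

text \<open>An excursion of \<open>q\<close> away from \<open>p\<close> pays \<open>4 * B\<close> per edge, while following \<open>p\<close> between its two ends
  would cost at most \<open>B\<close> times the sum of their distances to \<open>z\<close>. The excursion therefore has at most a
  quarter of that sum as its length, too little to come much closer to \<open>z\<close> than its ends, which are
  vertices of \<open>p\<close>.\<close>

lemma tame_geodesic_avoids_ball:
  assumes "z \<in> V" "1 \<le> B" "path_between V E x y p"
    and sparse: "\<And>i j. i \<le> j \<Longrightarrow> j \<le> path_length p \<Longrightarrow>
           real (j - i) \<le> B * (real (dist_g z (p ! i)) + real (dist_g z (p ! j)))"
    and q: "weighted_geodesic V E (tame_weight (4 * B) p) x y q"
    and v: "v \<in> set q"
  shows "\<exists>u\<in>set p. dist_g z u \<le> 2 * dist_g z v"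
proof (cases "v \<in> set p")
  case False
  let ?w = "tame_weight (4 * B) p"
  have C: "1 \<le> 4 * B" using assms by simp
  have nonneg: "\<forall>e\<in>E. 0 \<le> ?w e"
    using tame_weight_bounds(1)[OF C] by (meson order_trans zero_le_one)
  have qb: "path_between V E x y q" using q by (simp add: weighted_geodesic_def)
  have fp: "finite_path V E p" and fq: "finite_path V E q"
    using assms(3) qb by (auto simp: path_between_def)
  obtain k where k: "k \<le> path_length q" "q ! k = v" using in_set_path_nth[OF fq v] by metis
  have ends: "q ! 0 \<in> set p" "q ! path_length q \<in> set p"
    using path_between_nth[OF qb] path_between_nth[OF assms(3)] finite_path_length[OF fp]
    by (metis le_imp_less_Suc nth_mem order_refl zero_less_Suc)+
  \<comment> \<open>The last vertex of \<open>p\<close> before \<open>v\<close> on \<open>q\<close>, and the first one after \<open>v\<close>.\<close>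
  define a where "a = Max {i. i \<le> k \<and> q ! i \<in> set p}"
  define b where "b = Min {j. k \<le> j \<and> j \<le> path_length q \<and> q ! j \<in> set p}"
  have "a \<in> {i. i \<le> k \<and> q ! i \<in> set p}"
    unfolding a_def by (rule Max_in) (use ends in auto)
  then have a: "a < k" "q ! a \<in> set p" using False k(2) by (auto simp: le_less)
  have a_max: "q ! i \<notin> set p" if "a < i" "i \<le> k" for i
  proof
    assume "q ! i \<in> set p"
    then have "i \<le> a" unfolding a_def using that by (intro Max_ge) auto
    then show False using that by simp
  qed
  have "b \<in> {j. k \<le> j \<and> j \<le> path_length q \<and> q ! j \<in> set p}"
    unfolding b_def by (rule Min_in) (use ends k in auto)
  then have b: "k < b" "b \<le> path_length q" "q ! b \<in> set p" using False k(2) by (auto simp: le_less)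
  have b_min: "q ! i \<notin> set p" if "k \<le> i" "i < b" for i
  proof
    assume "q ! i \<in> set p"
    then have "b \<le> i" unfolding b_def using that b(2) by (intro Min_le) auto
    then show False using that by simp
  qed
  \<comment> \<open>Between \<open>a\<close> and \<open>b\<close> the geodesic uses no edge of \<open>p\<close>, so it pays full price there.\<close>
  have price: "?w {q ! i, q ! Suc i} = 4 * B" if "a \<le> i" "i < b" for i
  proof -
    have "q ! i \<notin> set p \<or> q ! Suc i \<notin> set p"
    proof (cases "i < k")
      case True
      then show ?thesis using that a_max[of "Suc i"] by simp
    next
      case False
      then show ?thesis using that b_min[of i] by simp
    qed
    moreover have "p ! m \<in> set p \<and> p ! Suc m \<in> set p" if "m < path_length p" for m
      using that finite_path_length[OF fp] by simp
    ultimately have "\<not> (\<exists>m<path_length p. {q ! i, q ! Suc i} = {p ! m, p ! Suc m})"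
      by (auto simp: doubleton_eq_iff)
    then show ?thesis by (simp only: tame_weight_def if_False)
  qed
  have ab: "a \<le> b" using a b by simp
  have excursion: "path_weight ?w (slice q a b) = 4 * B * real (b - a)"
    unfolding path_weight_slice[OF fq ab b(2)] using price by simp
  have shortcut: "\<exists>r. path_between V E (p ! i) (p ! j) r
      \<and> path_weight ?w r \<le> B * (real (dist_g z (p ! i)) + real (dist_g z (p ! j)))"
    if "i \<le> j" "j \<le> path_length p" for i j
  proof -
    have "path_weight ?w (slice p i j) = (\<Sum>m=i..<j. 1)"
      unfolding path_weight_slice[OF fp that] using that
      by (intro sum.cong refl tame_weight_on) auto
    then show ?thesis using path_between_slice[OF fp that] sparse[OF that] by auto
  qed
  \<comment> \<open>The excursion may leave \<open>p\<close> at a later vertex than the one where it comes back.\<close>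
  obtain i where i: "i \<le> path_length p" "p ! i = q ! a" using in_set_path_nth[OF fp a(2)] by metis
  obtain j where j: "j \<le> path_length p" "p ! j = q ! b" using in_set_path_nth[OF fp b(3)] by metis
  obtain r where r: "path_between V E (q ! a) (q ! b) r"
    "path_weight ?w r \<le> B * (real (dist_g z (q ! a)) + real (dist_g z (q ! b)))"
  proof (cases "i \<le> j")
    case True
    then show ?thesis using shortcut[of i j] i j that by auto
  next
    case False
    then obtain r where "path_between V E (q ! b) (q ! a) r"
      "path_weight ?w r \<le> B * (real (dist_g z (q ! b)) + real (dist_g z (q ! a)))"
      using shortcut[of j i] i j by auto
    then show ?thesis using path_between_rev(1,3) that by (metis add.commute)
  qed
  have "path_weight ?w (slice q a b) \<le> path_weight ?w r"
    using weighted_geodesic_le[OF weighted_geodesic_slice[OF q nonneg ab b(2)] nonneg r(1)] .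
  then have "B * (4 * real (b - a)) \<le> B * (real (dist_g z (q ! a)) + real (dist_g z (q ! b)))"
    using excursion r(2) by (simp add: mult_ac)
  then have 1: "4 * (b - a) \<le> dist_g z (q ! a) + dist_g z (q ! b)"
    using assms(2) by simp
  have inV: "q ! a \<in> V" "q ! b \<in> V" "v \<in> V"
    using finite_path_nth[OF fq] a b k by auto
  have 2: "dist_g z (q ! a) \<le> dist_g z v + (k - a)"
    using dist_triangle[of z v "q ! a"] dist_commute[of v "q ! a"] dist_le_diff[OF fq, of a k] inV assms(1) a k by auto
  have 3: "dist_g z (q ! b) \<le> dist_g z v + (b - k)"
    using dist_triangle[of z v "q ! b"] dist_le_diff[OF fq, of k b] inV assms(1) b k by auto
  have "dist_g z (q ! a) \<le> 2 * dist_g z v \<or> dist_g z (q ! b) \<le> 2 * dist_g z v"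
    using 1 2 3 a(1) b(1) by linarith
  then show ?thesis using a(2) b(3) by blast
qed force

section \<open>Paths with ends on opposite sides of a Morse quasi-geodesic\<close>

text \<open>Going along \<open>q\<close> there is a last vertex close to the nonpositive half of \<open>\<gamma>\<close>. Its successor,
  or the end \<open>\<gamma> t\<close> of \<open>q\<close> if there is none, is close to the nonnegative half, so two points of \<open>\<gamma>\<close> on opposite sides of \<open>\<gamma> 0\<close> are within \<open>2 * R + 1\<close> of
  each other. As \<open>\<gamma>\<close> is a quasi-geodesic, their indices, and hence \<open>\<gamma> 0\<close>, are close too.\<close>

lemma path_near_quasi_geodesic_meets_ball:
  assumes "quasi_geodesic_bi_infinite V E C K \<gamma>" "0 \<le> C" "0 \<le> K"
    and q: "path_between V E (\<gamma> s) (\<gamma> t) q" and "s \<le> 0" "0 \<le> t"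
    and near: "\<forall>v\<in>set q. \<exists>k. real (dist_g v (\<gamma> k)) \<le> R"
  shows "\<exists>v\<in>set q. real (dist_g (\<gamma> 0) v) \<le> R + (C * (2 * R + 1) + K)"
proof -
  have \<gamma>: "bi_infinite_path V E \<gamma>" using assms by (simp add: quasi_geodesic_bi_infinite_def)
  have inV: "\<gamma> k \<in> V" for k using \<gamma> by (simp add: bi_infinite_path_def)
  have fq: "finite_path V E q" using q by (simp add: path_between_def)
  have n: "q ! 0 = \<gamma> s" "q ! path_length q = \<gamma> t" using path_between_nth[OF q] by auto
  have R: "0 \<le> R"
    using near fq by (metis finite_path_def list.set_sel(1) of_nat_0_le_iff order_trans)
  define P where "P i \<longleftrightarrow> i \<le> path_length q \<and> (\<exists>k\<le>0. real (dist_g (q ! i) (\<gamma> k)) \<le> R)" for i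
  have "P 0" using n R assms dist_self[OF inV] by (auto simp: P_def intro!: exI[of _ s])
  moreover have bound: "i \<le> path_length q" if "P i" for i using that by (simp add: P_def)
  ultimately have "P (Greatest P)" "\<And>j. P j \<Longrightarrow> j \<le> Greatest P"
    by (auto intro: GreatestI_nat[of P 0 "path_length q"] Greatest_le_nat[of P _ "path_length q"])
  then obtain i where i: "P i" "\<And>j. P j \<Longrightarrow> j \<le> i" by blast
  obtain k where k: "k \<le> 0" "real (dist_g (q ! i) (\<gamma> k)) \<le> R" using i by (auto simp: P_def)
  have il: "i \<le> path_length q" using i by (simp add: P_def)
  have qi: "q ! i \<in> V" using finite_path_nth[OF fq il] .
  obtain k' where k': "0 \<le> k'" "real (dist_g (\<gamma> k) (\<gamma> k')) \<le> 2 * R + 1"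
  proof (cases "i = path_length q")
    case True
    then have "real (dist_g (\<gamma> k) (\<gamma> t)) \<le> 2 * R + 1"
      using k R n dist_commute[OF inV inV, of k t] by auto
    then show ?thesis using that assms by blast
  next
    case False
    then have Si: "Suc i \<le> path_length q" using il by simp
    have inS: "q ! Suc i \<in> V" using finite_path_nth[OF fq Si] .
    have "q ! Suc i \<in> set q" using Si finite_path_length[OF fq] by simp
    then obtain k' where k': "real (dist_g (q ! Suc i) (\<gamma> k')) \<le> R" using near by blast
    then have "\<not> k' \<le> 0" using i(2)[of "Suc i"] Si by (auto simp: P_def)
    moreover have "dist_g (\<gamma> k) (\<gamma> k') \<le> dist_g (q ! i) (\<gamma> k) + (1 + dist_g (q ! Suc i) (\<gamma> k'))"
      using dist_triangle[OF inV qi inV, of k k'] dist_triangle[OF qi inS inV, of k']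
        dist_commute[OF inV qi, of k] dist_le_diff[OF fq _ Si, of i] by simp
    ultimately show ?thesis using k k' that[of k'] by simp
  qed
  have "real_of_int (k' - k) \<le> C * real (dist_g (\<gamma> k) (\<gamma> k')) + K"
  proof (cases "k < k'")
    case True
    then show ?thesis using assms(1) by (auto simp: quasi_geodesic_bi_infinite_def)
  next
    case False
    then have "k' - k = 0" using k k' by simp
    then show ?thesis using assms by simp
  qed
  also have "\<dots> \<le> C * (2 * R + 1) + K" using k' assms by (intro add_mono mult_left_mono) auto
  finally have "real_of_int (- k) \<le> C * (2 * R + 1) + K" using k' by simp
  moreover have "int (dist_g (\<gamma> k) (\<gamma> 0)) \<le> - k"
    using bi_infinite_dist_le[OF \<gamma> k(1)] by simp
  moreover have "dist_g (\<gamma> 0) (q ! i) \<le> dist_g (\<gamma> k) (\<gamma> 0) + dist_g (q ! i) (\<gamma> k)"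
    using dist_triangle[OF inV inV qi, of 0 k] dist_commute[OF inV inV, of 0 k] dist_commute[OF qi inV, of k] by simp
  ultimately have "real (dist_g (\<gamma> 0) (q ! i)) \<le> R + (C * (2 * R + 1) + K)"
    using k by linarith
  moreover have "q ! i \<in> set q" using il finite_path_length[OF fq] by simp
  ultimately show ?thesis by blast
qed

text \<open>The path \<open>p\<close> need not be a quasi-geodesic: its pieces are only controlled by their distance to \<open>\<gamma> 0\<close>.
  The Morse property is applied instead to its tamed version, which stays close to \<open>\<gamma>\<close> and so comes
  close to \<open>\<gamma> 0\<close>, with constants that do not depend on \<open>p\<close>; and then so does \<open>p\<close>.\<close>

lemma morse_path_meets_ball:
  assumes "morse_quasi_geodesic V E \<gamma>" "1 \<le> B"
  obtains R where "\<And>p s t. \<lbrakk>path_between V E (\<gamma> s) (\<gamma> t) p; s \<le> 0; 0 \<le> t;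
      \<And>i j. i \<le> j \<Longrightarrow> j \<le> path_length p \<Longrightarrow>
        real (j - i) \<le> B * (real (dist_g (\<gamma> 0) (p ! i)) + real (dist_g (\<gamma> 0) (p ! j)))\<rbrakk>
    \<Longrightarrow> \<exists>v\<in>set p. real (dist_g (\<gamma> 0) v) \<le> R"
proof -
  obtain C K where CK: "1 \<le> C" "0 \<le> K" "quasi_geodesic_bi_infinite V E C K \<gamma>"
    using assms by (auto simp: morse_quasi_geodesic_def)
  obtain R where R: "\<And>p. quasi_geodesic_finite V E (4 * B) 1 p \<Longrightarrow> hd p \<in> range \<gamma> \<Longrightarrow> last p \<in> range \<gamma>
      \<Longrightarrow> \<forall>v\<in>set p. \<exists>k. real (dist_g v (\<gamma> k)) \<le> R"
  proof -
    have "1 \<le> 4 * B" "(0::real) < 1" using assms(2) by auto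
    then show ?thesis
      using that assms(1)[unfolded morse_quasi_geodesic_def, THEN conjunct2, rule_format, of "4 * B" 1]
      by blast
  qed
  let ?R = "R + (C * (2 * R + 1) + K)"
  have "\<exists>v\<in>set p. real (dist_g (\<gamma> 0) v) \<le> 2 * ?R"
    if p: "path_between V E (\<gamma> s) (\<gamma> t) p" and st: "s \<le> 0" "0 \<le> t"
      and sparse: "\<And>i j. i \<le> j \<Longrightarrow> j \<le> path_length p \<Longrightarrow>
        real (j - i) \<le> B * (real (dist_g (\<gamma> 0) (p ! i)) + real (dist_g (\<gamma> 0) (p ! j)))"
    for p s t
  proof -
    have inV: "\<gamma> k \<in> V" for k
      using CK(3) by (simp add: quasi_geodesic_bi_infinite_def bi_infinite_path_def)
    have B4: "1 \<le> 4 * B" using assms by simp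
    obtain q where q: "weighted_geodesic V E (tame_weight (4 * B) p) (\<gamma> s) (\<gamma> t) q"
      using tame_geodesic_exists[OF B4 inV inV] by metis
    then have qb: "path_between V E (\<gamma> s) (\<gamma> t) q" by (simp add: weighted_geodesic_def)
    have "\<forall>v\<in>set q. \<exists>k. real (dist_g v (\<gamma> k)) \<le> R"
      using R tame_geodesic_quasi_geodesic[OF B4 _ q, of 1] qb by (auto simp: path_between_def)
    then obtain v where v: "v \<in> set q" "real (dist_g (\<gamma> 0) v) \<le> ?R"
      using path_near_quasi_geodesic_meets_ball[OF CK(3) _ CK(2) qb st] CK(1) by fastforce
    obtain u where u: "u \<in> set p" "dist_g (\<gamma> 0) u \<le> 2 * dist_g (\<gamma> 0) v"
      using tame_geodesic_avoids_ball[OF inV assms(2) p sparse q v(1)] by blast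
    have "real (dist_g (\<gamma> 0) u) \<le> 2 * real (dist_g (\<gamma> 0) v)" using u(2) by linarith
    also have "\<dots> \<le> 2 * ?R" using v(2) by (rule mult_left_mono) simp
    finally show ?thesis using u(1) by blast
  qed
  then show ?thesis using that by blast
qed

end

section \<open>Large deviations for the weights of paths\<close>

lemma distinct_path_edges_inj:
  assumes "finite_path V E p" "distinct p"
  shows "inj_on (\<lambda>i. {p ! i, p ! Suc i}) {..<path_length p}"
proof (rule inj_onI)
  fix i j assume ij: "i \<in> {..<path_length p}" "j \<in> {..<path_length p}"
    and eq: "{p ! i, p ! Suc i} = {p ! j, p ! Suc j}"
  have l: "length p = Suc (path_length p)" using finite_path_length[OF assms(1)] .
  have nth: "p ! a = p ! b \<longleftrightarrow> a = b" if "a \<le> path_length p" "b \<le> path_length p" for a b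
    using nth_eq_iff_index_eq[OF assms(2), of a b] that l by simp
  show "i = j"
    using eq ij nth[of i j] nth[of i "Suc j"] nth[of "Suc i" j] by (auto simp: doubleton_eq_iff)
qed

locale edge_law = prob_space \<nu> for \<nu> :: "real measure" +
  assumes sets_law: "sets \<nu> = sets (restrict_space borel {0..})"
begin

lemma space_law: "space \<nu> = {0..}"
  using sets_eq_imp_space_eq[OF sets_law] by (simp add: space_restrict_space)

lemma measurable_law: "f \<in> borel_measurable borel \<Longrightarrow> f \<in> borel_measurable \<nu>"
  unfolding measurable_cong_sets[OF sets_law refl] by (rule measurable_restrict_space1)

lemma prob_space_fpp: "prob_space (fpp_measure E \<nu>)"
  unfolding fpp_measure_def by (intro prob_space_PiM prob_space_axioms)

lemma measurable_edge: "e \<in> E \<Longrightarrow> (\<lambda>\<omega>. \<omega> e) \<in> borel_measurable (fpp_measure E \<nu>)"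
  unfolding fpp_measure_def
  using measurable_compose[OF measurable_component_singleton[of e E "\<lambda>_. \<nu>"] measurable_law[OF measurable_ident]]
  by simp

lemma measurable_path_weight:
  "finite_path V E p \<Longrightarrow> (\<lambda>\<omega>. path_weight \<omega> p) \<in> borel_measurable (fpp_measure E \<nu>)"
  unfolding path_weight_def by (intro borel_measurable_sum measurable_edge) (auto dest: finite_path_edge)

lemma nn_integral_edge:
  assumes "e \<in> E" "f \<in> borel_measurable borel"
  shows "(\<integral>\<^sup>+\<omega>. f (\<omega> e) \<partial>fpp_measure E \<nu>) = (\<integral>\<^sup>+x. f x \<partial>\<nu>)"
proof -
  have "(\<integral>\<^sup>+x. f x \<partial>\<nu>) = (\<integral>\<^sup>+x. f x \<partial>distr (fpp_measure E \<nu>) \<nu> (\<lambda>\<omega>. \<omega> e))"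
    unfolding fpp_measure_def by (simp only: distr_PiM_component[OF prob_space_axioms assms(1)])
  also have "\<dots> = (\<integral>\<^sup>+\<omega>. f (\<omega> e) \<partial>fpp_measure E \<nu>)"
    unfolding fpp_measure_def
    by (rule nn_integral_distr[OF measurable_component_singleton[OF assms(1)]])
      (simp add: measurable_law[OF assms(2)])
  finally show ?thesis ..
qed

definition exp_moment :: "real \<Rightarrow> ennreal" where
  "exp_moment s = (\<integral>\<^sup>+x. ennreal (exp (s * x)) \<partial>\<nu>)"

text \<open>The edges of a path without repeated vertices are distinct, so their weights are independent.\<close>

lemma exp_moment_path:
  assumes p: "finite_path V E p" "distinct p"
  shows "(\<integral>\<^sup>+\<omega>. ennreal (exp (s * path_weight \<omega> p)) \<partial>fpp_measure E \<nu>) = exp_moment s ^ path_length p"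
proof -
  interpret fpp: prob_space "fpp_measure E \<nu>" by (rule prob_space_fpp)
  let ?I = "{..<path_length p}"
  let ?e = "\<lambda>i. {p ! i, p ! Suc i}"
  have e: "?e i \<in> E" if "i \<in> ?I" for i using finite_path_edge[OF p(1)] that by simp
  have indep: "fpp.indep_vars (\<lambda>_. \<nu>) (\<lambda>i \<omega>. \<omega> i) (?e ` ?I)"
  proof -
    have "fpp.indep_vars (\<lambda>_. \<nu>) (\<lambda>i \<omega>. \<omega> i) E"
    proof (cases "E = {}")
      case False
      have "distr (fpp_measure E \<nu>) (\<Pi>\<^sub>M i\<in>E. \<nu>) (\<lambda>\<omega>. \<lambda>i\<in>E. \<omega> i)
          = distr (fpp_measure E \<nu>) (fpp_measure E \<nu>) (\<lambda>\<omega>. \<omega>)"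
        unfolding fpp_measure_def by (intro distr_cong) (auto simp: space_PiM)
      also have "\<dots> = (\<Pi>\<^sub>M i\<in>E. distr (fpp_measure E \<nu>) \<nu> (\<lambda>\<omega>. \<omega> i))"
        unfolding fpp_measure_def distr_id
        by (intro PiM_cong refl distr_PiM_component[symmetric] prob_space_axioms)
      finally show ?thesis
        using False
        by (subst fpp.indep_vars_iff_distr_eq_PiM') (auto simp: fpp_measure_def)
    next
      case True
      then show ?thesis unfolding fpp.indep_vars_def fpp.indep_sets_def by auto
    qed
    then show ?thesis by (rule fpp.indep_vars_subset) (use e in auto)
  qed
  then have indep: "fpp.indep_vars (\<lambda>_. borel) (\<lambda>i \<omega>. ennreal (exp (s * \<omega> i))) (?e ` ?I)"
    by (rule fpp.indep_vars_compose2[where X = "\<lambda>i \<omega>. \<omega> i"]) (auto intro!: measurable_law)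
  have "(\<integral>\<^sup>+\<omega>. ennreal (exp (s * path_weight \<omega> p)) \<partial>fpp_measure E \<nu>)
      = (\<integral>\<^sup>+\<omega>. (\<Prod>e\<in>?e ` ?I. ennreal (exp (s * \<omega> e))) \<partial>fpp_measure E \<nu>)"
  proof (intro nn_integral_cong)
    fix \<omega>
    have "exp (s * path_weight \<omega> p) = (\<Prod>i\<in>?I. exp (s * \<omega> (?e i)))"
      unfolding path_weight_def sum_distrib_left by (rule exp_sum) simp
    also have "ennreal \<dots> = (\<Prod>i\<in>?I. ennreal (exp (s * \<omega> (?e i))))"
      by (rule prod_ennreal[symmetric]) simp
    also have "\<dots> = (\<Prod>e\<in>?e ` ?I. ennreal (exp (s * \<omega> e)))"
      by (simp add: prod.reindex[OF distinct_path_edges_inj[OF p]])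
    finally show "ennreal (exp (s * path_weight \<omega> p)) = (\<Prod>e\<in>?e ` ?I. ennreal (exp (s * \<omega> e)))" .
  qed
  also have "\<dots> = (\<Prod>e\<in>?e ` ?I. \<integral>\<^sup>+\<omega>. ennreal (exp (s * \<omega> e)) \<partial>fpp_measure E \<nu>)"
    by (rule fpp.indep_vars_nn_integral[OF _ indep]) auto
  also have "\<dots> = (\<Prod>e\<in>?e ` ?I. exp_moment s)"
    unfolding exp_moment_def using e by (intro prod.cong refl nn_integral_edge) auto
  also have "\<dots> = exp_moment s ^ path_length p"
    by (simp add: card_image[OF distinct_path_edges_inj[OF p]])
  finally show ?thesis .
qed

text \<open>The sign of \<open>s\<close> selects the tail: \<open>s > 0\<close> bounds the probability that the path weighs at least
  \<open>a\<close> per edge, \<open>s < 0\<close> the probability that it weighs at most \<open>a\<close> per edge.\<close>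

lemma chernoff_path:
  fixes s a :: real
  assumes p: "finite_path V E p" "distinct p"
  shows "emeasure (fpp_measure E \<nu>)
           {\<omega>\<in>space (fpp_measure E \<nu>). s * a * path_length p \<le> s * path_weight \<omega> p}
         \<le> (ennreal (exp (- (s * a))) * exp_moment s) ^ path_length p"
proof -
  let ?M = "fpp_measure E \<nu>" and ?L = "path_length p"
  let ?u = "\<lambda>\<omega>. ennreal (exp (s * path_weight \<omega> p))"
  have [measurable]: "(\<lambda>\<omega>. path_weight \<omega> p) \<in> borel_measurable ?M" by (rule measurable_path_weight[OF p(1)])
  have "{\<omega>\<in>space ?M. s * a * ?L \<le> s * path_weight \<omega> p}
      = {\<omega>\<in>space ?M. 1 \<le> ennreal (exp (- (s * a * ?L))) * ?u \<omega>}"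
    by (auto simp flip: ennreal_mult ennreal_1 exp_add)
  also have "emeasure ?M \<dots> \<le> ennreal (exp (- (s * a * ?L))) * (\<integral>\<^sup>+\<omega>. ?u \<omega> * indicator (space ?M) \<omega> \<partial>?M)"
    by (rule nn_integral_Markov_inequality) auto
  also have "(\<integral>\<^sup>+\<omega>. ?u \<omega> * indicator (space ?M) \<omega> \<partial>?M) = exp_moment s ^ ?L"
    unfolding exp_moment_path[OF p, of s, symmetric] by (intro nn_integral_cong) simp
  also have "ennreal (exp (- (s * a * ?L))) = ennreal (exp (- (s * a))) ^ ?L"
    by (simp add: ennreal_power exp_of_nat_mult[symmetric] mult_ac)
  finally show ?thesis by (simp add: power_mult_distrib)
qed

lemma AE_law_pos:
  assumes "measure \<nu> {0} = 0"
  shows "AE x in \<nu>. 0 < x"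
proof -
  have "{0} \<in> sets \<nu>" unfolding sets_law by (auto simp: sets_restrict_space image_iff intro!: bexI[of _ "{0}"])
  then have "AE x in \<nu>. x \<notin> {0}"
    using assms by (intro AE_not_in) (simp add: null_sets_def emeasure_eq_measure)
  then show ?thesis by (rule AE_mp) (auto simp: space_law intro!: AE_I2)
qed

text \<open>As the law has no atom at \<open>0\<close>, the functions \<open>exp (- (n * x))\<close> tend to \<open>0\<close> almost everywhere, and
  they are dominated by \<open>1\<close>.\<close>

lemma exp_moment_small:
  assumes "measure \<nu> {0} = 0" "0 < \<epsilon>"
  obtains s where "0 < s" "exp_moment (- s) \<le> ennreal \<epsilon>"
proof -
  have meas: "(\<lambda>x. exp (- real n * x)) \<in> borel_measurable \<nu>" for n
    by (rule measurable_law) measurable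
  have "(\<lambda>n. \<integral>x. exp (- real n * x) \<partial>\<nu>) \<longlonglongrightarrow> (\<integral>x. 0 \<partial>\<nu>)"
  proof (rule integral_dominated_convergence[where w = "\<lambda>_. 1"])
    show "AE x in \<nu>. (\<lambda>n. exp (- real n * x)) \<longlonglongrightarrow> 0"
      using AE_law_pos[OF assms(1)]
    proof eventually_elim
      case (elim x)
      have "(\<lambda>n. (exp (- x)) ^ n) \<longlonglongrightarrow> 0" using elim by (intro LIMSEQ_power_zero) simp
      then show ?case by (simp add: exp_of_nat_mult[symmetric])
    qed
  qed (use meas in \<open>auto simp: space_law\<close>)
  then have "eventually (\<lambda>n. (\<integral>x. exp (- real n * x) \<partial>\<nu>) < \<epsilon>) sequentially"
    using assms(2) by (intro order_tendstoD) auto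
  then obtain N where N: "\<And>n. N \<le> n \<Longrightarrow> (\<integral>x. exp (- real n * x) \<partial>\<nu>) < \<epsilon>"
    by (auto simp: eventually_sequentially)
  define n where "n = Suc N"
  have n: "(\<integral>x. exp (- real n * x) \<partial>\<nu>) < \<epsilon>" "0 < n"
    using N[of n] by (simp_all add: n_def)
  have "integrable \<nu> (\<lambda>x. exp (- real n * x))"
    by (rule integrable_const_bound[of _ 1]) (use meas in \<open>auto simp: space_law\<close>)
  then have "exp_moment (- real n) = ennreal (\<integral>x. exp (- real n * x) \<partial>\<nu>)"
    unfolding exp_moment_def by (intro nn_integral_eq_integral) auto
  then have "exp_moment (- real n) \<le> ennreal \<epsilon>" using n(1) by (simp add: ennreal_leI)
  then show ?thesis using that[of "real n"] n(2) by simp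
qed

end

locale fpp = bounded_degree_graph V E D + edge_law \<nu>
  for V :: "'v set" and E D \<nu>
begin

text \<open>There are at most \<open>(2 * D\<^sup>2) ^ n\<close> paths to consider, and each is exceptional with probability at
  most \<open>(1 / (4 * D\<^sup>2)) ^ n\<close>. So some path of length \<open>n\<close> is exceptional with probability at most
  \<open>(1 / 2) ^ n\<close>, and the Borel-Cantelli lemma applies.\<close>

lemma near_paths_weight:
  assumes "x \<in> V" and small: "ennreal (exp (- (s * a))) * exp_moment s \<le> ennreal (1 / (4 * real D ^ 2))"
  shows "AE \<omega> in fpp_measure E \<nu>. \<exists>N. \<forall>n\<ge>N. \<forall>p\<in>near_paths x n. s * path_weight \<omega> p < s * a * real n"
proof -
  let ?M = "fpp_measure E \<nu>"
  interpret M: prob_space ?M by (rule prob_space_fpp)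
  let ?B = "\<lambda>p. {\<omega>\<in>space ?M. s * a * path_length p \<le> s * path_weight \<omega> p}"
  define A where "A n = (\<Union>p\<in>near_paths x n. ?B p)" for n
  have path: "finite_path V E p" "distinct p" "path_length p = n" if "p \<in> near_paths x n" for p n
    using that by (auto simp: near_paths_def)
  have B_sets: "?B p \<in> sets ?M" if "p \<in> near_paths x n" for p n
  proof -
    have [measurable]: "(\<lambda>\<omega>. path_weight \<omega> p) \<in> borel_measurable ?M"
      by (rule measurable_path_weight[OF path(1)[OF that]])
    show ?thesis by measurable
  qed
  have fin: "finite (near_paths x n)" for n by (rule near_paths_count[OF assms(1)])
  have A_sets: "A n \<in> sets ?M" for n
    unfolding A_def using fin B_sets by (intro sets.finite_UN) auto
  have D: "0 < real D" using D_pos by simp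
  have "emeasure ?M (A n) \<le> ennreal ((1 / 2) ^ n)" for n
  proof -
    have "emeasure ?M (A n) \<le> (\<Sum>p\<in>near_paths x n. emeasure ?M (?B p))"
      unfolding A_def using fin B_sets by (intro emeasure_subadditive_finite) auto
    also have "\<dots> \<le> (\<Sum>p\<in>near_paths x n. ennreal (1 / (4 * real D ^ 2)) ^ n)"
    proof (rule sum_mono)
      fix p assume p: "p \<in> near_paths x n"
      have "emeasure ?M (?B p) \<le> (ennreal (exp (- (s * a))) * exp_moment s) ^ path_length p"
        using chernoff_path path[OF p] by blast
      also have "\<dots> \<le> ennreal (1 / (4 * real D ^ 2)) ^ n"
        using path[OF p] small by (auto intro: power_mono)
      finally show "emeasure ?M (?B p) \<le> ennreal (1 / (4 * real D ^ 2)) ^ n" .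
    qed
    also have "\<dots> = ennreal (real (card (near_paths x n)) * (1 / (4 * real D ^ 2)) ^ n)"
      by (simp add: ennreal_power ennreal_mult ennreal_of_nat_eq_real_of_nat)
    also have "\<dots> \<le> ennreal ((2 * real D ^ 2) ^ n * (1 / (4 * real D ^ 2)) ^ n)"
    proof (intro ennreal_leI mult_right_mono)
      show "real (card (near_paths x n)) \<le> (2 * real D ^ 2) ^ n"
        using near_paths_count(2)[OF assms(1), of n, THEN of_nat_mono[where 'a = real]] by simp
    qed simp
    also have "(2 * real D ^ 2) ^ n * (1 / (4 * real D ^ 2)) ^ n = (1 / 2) ^ n"
    proof -
      have "2 * real D ^ 2 * (1 / (4 * real D ^ 2)) = 1 / 2" using D by simp
      then show ?thesis by (simp only: power_mult_distrib[symmetric])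
    qed
    finally show ?thesis .
  qed
  then have small: "measure ?M (A n) \<le> (1 / 2) ^ n" for n
    by (simp add: M.emeasure_eq_measure)
  have "summable (\<lambda>n. measure ?M (A n))"
  proof (rule summable_comparison_test')
    show "summable (\<lambda>n. (1 / 2 :: real) ^ n)" by (rule summable_geometric) simp
    show "norm (measure ?M (A n)) \<le> (1 / 2) ^ n" for n using small[of n] by simp
  qed
  then have "AE \<omega> in ?M. eventually (\<lambda>n. \<omega> \<in> space ?M - A n) sequentially"
    by (intro borel_cantelli_AE1 A_sets) (auto simp: M.emeasure_eq_measure)
  then show ?thesis
  proof eventually_elim
    case (elim \<omega>)
    then obtain N where N: "\<And>n. N \<le> n \<Longrightarrow> \<omega> \<in> space ?M - A n"
      by (auto simp: eventually_sequentially)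
    have "s * path_weight \<omega> p < s * a * real n" if "N \<le> n" "p \<in> near_paths x n" for n p
      using N[OF that(1)] that(2) path(3)[OF that(2)] by (auto simp: A_def not_le)
    then show ?case by blast
  qed
qed

text \<open>The two halves of the comparison between weights and lengths. For the lower bound the
  exponential rate \<open>s\<close> is chosen first, large enough to beat the number of paths, and then \<open>c = 1 / s\<close>
  costs only a factor \<open>exp 1\<close>. For the upper bound the rate is dictated by the available moment, and
  \<open>b\<close> is taken large.\<close>

lemma linear_lower_bound:
  assumes "x \<in> V" "measure \<nu> {0} = 0"
  obtains c where "0 < c"
    "AE \<omega> in fpp_measure E \<nu>. \<exists>N. \<forall>n\<ge>N. \<forall>p\<in>near_paths x n. c * real n < path_weight \<omega> p"
proof -
  have D: "0 < real D" using D_pos by simp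
  let ?\<epsilon> = "exp (- 1) * (1 / (4 * real D ^ 2))"
  have "0 < ?\<epsilon>" using D by simp
  then obtain s where s: "0 < s" "exp_moment (- s) \<le> ennreal ?\<epsilon>"
    using exp_moment_small[OF assms(2)] by metis
  have "ennreal (exp (- (- s * (1 / s)))) * exp_moment (- s) \<le> ennreal (exp 1) * ennreal ?\<epsilon>"
    using s by (intro mult_mono) auto
  also have "\<dots> = ennreal (exp 1 * ?\<epsilon>)" by (rule ennreal_mult[symmetric]) auto
  also have "exp 1 * ?\<epsilon> = 1 / (4 * real D ^ 2)" by (simp add: exp_minus)
  finally have "AE \<omega> in fpp_measure E \<nu>. \<exists>N. \<forall>n\<ge>N. \<forall>p\<in>near_paths x n.
      - s * path_weight \<omega> p < - s * (1 / s) * real n"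
    by (rule near_paths_weight[OF assms(1)])
  then have "AE \<omega> in fpp_measure E \<nu>. \<exists>N. \<forall>n\<ge>N. \<forall>p\<in>near_paths x n. (1 / s) * real n < path_weight \<omega> p"
  proof (rule AE_mp, intro AE_I2 impI)
    fix \<omega> assume "\<exists>N. \<forall>n\<ge>N. \<forall>p\<in>near_paths x n. - s * path_weight \<omega> p < - s * (1 / s) * real n"
    moreover have "- s * w < - s * (1 / s) * m \<longleftrightarrow> (1 / s) * m < w" for w m
      using s(1) by (simp add: field_simps)
    ultimately show "\<exists>N. \<forall>n\<ge>N. \<forall>p\<in>near_paths x n. (1 / s) * real n < path_weight \<omega> p" by simp
  qed
  then show ?thesis using that[of "1 / s"] s(1) by simp
qed

lemma linear_upper_bound:
  assumes "x \<in> V" "0 < c" "exp_moment c < \<infinity>"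
  obtains b where "0 < b"
    "AE \<omega> in fpp_measure E \<nu>. \<exists>N. \<forall>n\<ge>N. \<forall>p\<in>near_paths x n. path_weight \<omega> p < b * real n"
proof -
  have D: "0 < real D" using D_pos by simp
  obtain m where m: "exp_moment c = ennreal m" "0 \<le> m"
    using assms(3) by (cases "exp_moment c") auto
  define k where "k = m * (4 * real D ^ 2) + 1"
  have k: "1 \<le> k" using m by (simp add: k_def)
  \<comment> \<open>This makes \<open>exp (c * b)\<close> exceed \<open>k\<close>, and so \<open>4 * D\<^sup>2\<close> times the moment; adding \<open>1\<close> ensures \<open>b > 0\<close>.\<close>
  define b where "b = (ln k + 1) / c"
  have b: "0 < b" "c * b = ln k + 1" using assms(2) k by (auto simp: b_def add_nonneg_pos)
  have "exp (- (c * b)) * m \<le> exp (- ln k) * m"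
    using b m by (intro mult_right_mono) auto
  also have "exp (- ln k) * m = m / k" using k by (simp add: exp_minus field_simps)
  also have "\<dots> \<le> 1 / (4 * real D ^ 2)"
    using k D unfolding k_def by (simp add: field_simps)
  finally have "ennreal (exp (- (c * b))) * exp_moment c \<le> ennreal (1 / (4 * real D ^ 2))"
    unfolding m(1) using m(2) by (simp add: ennreal_leI flip: ennreal_mult)
  from near_paths_weight[OF assms(1) this]
  have "AE \<omega> in fpp_measure E \<nu>. \<exists>N. \<forall>n\<ge>N. \<forall>p\<in>near_paths x n. path_weight \<omega> p < b * real n"
    using assms(2) by (simp add: mult.assoc)
  then show ?thesis using that b(1) by simp
qed

end

context bounded_degree_graph
begin

section \<open>Geodesics cross a ball\<close>

text \<open>Vertices far from \<open>z\<close> are reached by a shortest path, to which the upper bound applies. The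
  finitely many others are absorbed in the constant \<open>K\<close>.\<close>

lemma upper_bound_all_vertices:
  assumes "z \<in> V" and nonneg: "\<forall>e\<in>E. 0 \<le> \<omega> e"
    and upper: "\<forall>n\<ge>N. \<forall>p\<in>near_paths z n. path_weight \<omega> p < b * real n"
    and "0 \<le> b"
  obtains K where "0 \<le> K"
    "\<And>u. u \<in> V \<Longrightarrow> \<exists>r. path_between V E z u r \<and> path_weight \<omega> r \<le> b * real (dist_g z u) + K"
proof -
  have "\<forall>u\<in>V. \<exists>r. path_between V E z u r" using assms(1) connected by (auto simp: connected_graph_def)
  then obtain r where r: "\<And>u. u \<in> V \<Longrightarrow> path_between V E z u (r u)" by metis
  let ?F = "{u\<in>V. dist_g z u \<le> N}"
  define K where "K = (\<Sum>u\<in>?F. path_weight \<omega> (r u))"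
  have r_nonneg: "0 \<le> path_weight \<omega> (r u)" if "u \<in> V" for u
    using path_weight_nonneg[OF _ nonneg] r[OF that] by (auto simp: path_between_def)
  have K: "0 \<le> K" unfolding K_def using r_nonneg by (intro sum_nonneg) auto
  have "\<exists>r. path_between V E z u r \<and> path_weight \<omega> r \<le> b * real (dist_g z u) + K" if u: "u \<in> V" for u
  proof (cases "dist_g z u \<le> N")
    case True
    have "path_weight \<omega> (r u) \<le> K"
      unfolding K_def using True u r_nonneg finite_ball[OF assms(1)] by (intro member_le_sum) auto
    moreover have "0 \<le> b * real (dist_g z u)" using assms by simp
    ultimately show ?thesis using r[OF u] by (intro exI[of _ "r u"]) simp
  next
    case False
    obtain q where q: "path_between V E z u q" "path_length q = dist_g z u"
      using dist_path[OF assms(1) u] by metis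
    obtain q' where q': "path_between V E z u q'" "distinct q'" "path_length q' \<le> path_length q"
      using distinct_path_exists[OF q(1) nonneg] by blast
    then have len: "path_length q' = dist_g z u" using dist_le_length[OF q'(1)] q(2) by simp
    have "q' \<in> near_paths z (dist_g z u)"
      using q' len dist_self[OF assms(1)] by (simp add: near_paths_def path_between_def)
    then have "path_weight \<omega> q' < b * real (dist_g z u)" using upper False by simp
    then show ?thesis using q'(1) K by (intro exI[of _ q']) simp
  qed
  then show ?thesis using that K by blast
qed

text \<open>A piece of a geodesic weighs no more than the detour through \<open>z\<close>, hence at most about \<open>b\<close> times
  the sum of the distances of its ends to \<open>z\<close>; on the other hand it weighs at least \<open>c\<close> per edge. The
  constants \<open>N\<close> and \<open>K\<close>, which depend on the configuration \<open>\<omega>\<close>, are dominated by the distance to \<open>z\<close> as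
  soon as the geodesic stays far from \<open>z\<close>. So the factor \<open>b / c + 2\<close> does not depend on \<open>\<omega>\<close>.\<close>

lemma geodesic_sparse:
  assumes z: "z \<in> V" and pos: "\<forall>e\<in>E. 0 < \<omega> e"
    and lower: "\<forall>n\<ge>N. \<forall>p\<in>near_paths z n. c * real n < path_weight \<omega> p" and c: "0 < c"
    and upper: "\<And>u. u \<in> V \<Longrightarrow>
          \<exists>r. path_between V E z u r \<and> path_weight \<omega> r \<le> b * real (dist_g z u) + K"
    and b: "0 \<le> b"
    and p: "weighted_geodesic V E \<omega> x y p"
    and far: "\<forall>v\<in>set p. real N + 2 * K / c \<le> real (dist_g z v)" and K: "0 \<le> K"
    and ij: "i \<le> j" "j \<le> path_length p"
  shows "real (j - i) \<le> (b / c + 2) * (real (dist_g z (p ! i)) + real (dist_g z (p ! j)))"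
proof -
  have nonneg: "\<forall>e\<in>E. 0 \<le> \<omega> e" using pos by (auto intro: less_imp_le)
  have fp: "finite_path V E p" using p by (simp add: weighted_geodesic_def path_between_def)
  have distinct: "distinct p" using weighted_geodesic_distinct[OF p pos] .
  let ?di = "real (dist_g z (p ! i))" and ?dj = "real (dist_g z (p ! j))"
  have inV: "p ! i \<in> V" "p ! j \<in> V" using finite_path_nth[OF fp] ij by auto
  have "p ! i \<in> set p" using ij finite_path_length[OF fp] by simp
  then have far_i: "real N + 2 * K / c \<le> ?di" using far by blast
  have frac: "0 \<le> 2 * K / c" using K c by simp
  have bc: "0 \<le> b / c * (?di + ?dj)" using b c by simp
  have "real (j - i) \<le> b / c * (?di + ?dj) + ?di"
  proof (cases "real (j - i) \<le> ?di")
    case True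
    then show ?thesis using bc by linarith
  next
    case False
    note s = path_between_slice[OF fp ij] slice_length(1)[OF fp ij]
    have "slice p i j \<in> near_paths z (j - i)"
      using s distinct_slice[OF distinct] False by (simp add: near_paths_def path_between_def)
    moreover have "N \<le> j - i" using False far_i frac by linarith
    ultimately have 1: "c * real (j - i) < path_weight \<omega> (slice p i j)" using lower by blast
    obtain r where r: "path_between V E z (p ! i) r" "path_weight \<omega> r \<le> b * ?di + K"
      using upper[OF inV(1)] by blast
    obtain r' where r': "path_between V E z (p ! j) r'" "path_weight \<omega> r' \<le> b * ?dj + K"
      using upper[OF inV(2)] by blast
    note rev = path_between_rev[OF r(1)]
    have "path_weight \<omega> (slice p i j) \<le> path_weight \<omega> (path_join (rev r) r')"
      using weighted_geodesic_le[OF weighted_geodesic_slice[OF p nonneg ij] nonneg]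
        path_between_join(1)[OF rev(1) r'(1)] by blast
    also have "\<dots> = path_weight \<omega> r + path_weight \<omega> r'"
      using path_between_join(3)[OF rev(1) r'(1)] rev(3) by simp
    finally have "c * real (j - i) \<le> b * (?di + ?dj) + 2 * K"
      using 1 r(2) r'(2) by (simp add: algebra_simps)
    then have "real (j - i) \<le> (b * (?di + ?dj) + 2 * K) / c"
      using c by (simp add: pos_le_divide_eq mult.commute)
    also have "\<dots> = b / c * (?di + ?dj) + 2 * K / c" by (simp add: add_divide_distrib)
    finally show ?thesis using far_i by linarith
  qed
  also have "\<dots> \<le> b / c * (?di + ?dj) + 2 * (?di + ?dj)" by simp
  finally show ?thesis by (simp only: distrib_right)
qed

text \<open>A geodesic that avoids a large ball is sparse, hence meets a ball whose radius is determined by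
  the graph, \<open>\<gamma>\<close> and the factor \<open>b / c + 2\<close> alone: a contradiction if the first ball is chosen larger than
  the second.\<close>

lemma geodesics_meet_ball:
  assumes morse: "morse_quasi_geodesic V E \<gamma>" and pos: "\<forall>e\<in>E. 0 < \<omega> e"
    and lower: "\<forall>n\<ge>N. \<forall>p\<in>near_paths (\<gamma> 0) n. c * real n < path_weight \<omega> p" and c: "0 < c"
    and upper: "\<forall>n\<ge>N'. \<forall>p\<in>near_paths (\<gamma> 0) n. path_weight \<omega> p < b * real n" and b: "0 \<le> b"
  obtains R :: nat where "\<And>s t p. \<lbrakk>weighted_geodesic V E \<omega> (\<gamma> s) (\<gamma> t) p; s \<le> 0; 0 \<le> t\<rbrakk>
    \<Longrightarrow> \<exists>v\<in>set p. dist_g (\<gamma> 0) v \<le> R"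
proof -
  have z: "\<gamma> 0 \<in> V"
    using morse by (auto simp: morse_quasi_geodesic_def quasi_geodesic_bi_infinite_def bi_infinite_path_def)
  have nonneg: "\<forall>e\<in>E. 0 \<le> \<omega> e" using pos by (auto intro: less_imp_le)
  obtain K where K: "0 \<le> K" "\<And>u. u \<in> V \<Longrightarrow>
      \<exists>r. path_between V E (\<gamma> 0) u r \<and> path_weight \<omega> r \<le> b * real (dist_g (\<gamma> 0) u) + K"
    using upper_bound_all_vertices[OF z nonneg upper b] by blast
  let ?B = "b / c + 2"
  have B: "1 \<le> ?B" using b c by (simp add: add_increasing)
  obtain R where R: "\<And>p s t. \<lbrakk>path_between V E (\<gamma> s) (\<gamma> t) p; s \<le> 0; 0 \<le> t;
      \<And>i j. i \<le> j \<Longrightarrow> j \<le> path_length p \<Longrightarrow>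
        real (j - i) \<le> ?B * (real (dist_g (\<gamma> 0) (p ! i)) + real (dist_g (\<gamma> 0) (p ! j)))\<rbrakk>
    \<Longrightarrow> \<exists>v\<in>set p. real (dist_g (\<gamma> 0) v) \<le> R"
    using morse_path_meets_ball[OF morse B] by blast
  let ?R = "max R (real N + 2 * K / c)"
  have "\<exists>v\<in>set p. dist_g (\<gamma> 0) v \<le> nat \<lceil>?R\<rceil>"
    if p: "weighted_geodesic V E \<omega> (\<gamma> s) (\<gamma> t) p" and st: "s \<le> 0" "0 \<le> t" for s t p
  proof (rule ccontr)
    assume *: "\<not> (\<exists>v\<in>set p. dist_g (\<gamma> 0) v \<le> nat \<lceil>?R\<rceil>)"
    have far: "?R < real (dist_g (\<gamma> 0) v)" if "v \<in> set p" for v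
    proof -
      have "nat \<lceil>?R\<rceil> < dist_g (\<gamma> 0) v" using * that by (meson not_le)
      then show ?thesis by linarith
    qed
    have far': "\<forall>v\<in>set p. real N + 2 * K / c \<le> real (dist_g (\<gamma> 0) v)"
      using far by (simp add: less_imp_le)
    have "path_between V E (\<gamma> s) (\<gamma> t) p" using p by (simp add: weighted_geodesic_def)
    from R[OF this st geodesic_sparse[OF z pos lower c K(2) b p far' K(1)]]
    obtain v where "v \<in> set p" "real (dist_g (\<gamma> 0) v) \<le> R" by blast
    then show False using far[of v] by simp
  qed
  then show ?thesis using that by blast
qed

lemma geodesic_exists_of_linear_lower_bound:
  assumes "z \<in> V" "x \<in> V" "y \<in> V" and nonneg: "\<forall>e\<in>E. 0 \<le> \<omega> e"
    and lower: "\<forall>n\<ge>N. \<forall>p\<in>near_paths z n. c * real n < path_weight \<omega> p" and c: "0 < c"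
  obtains p where "weighted_geodesic V E \<omega> x y p"
proof (rule weighted_geodesic_exists[OF assms(2,3) nonneg])
  fix M :: real
  obtain m :: nat where m: "M / c \<le> real m" using real_arch_simple by blast
  have "M \<le> path_weight \<omega> p"
    if p: "finite_path V E p" "distinct p" "hd p = x" "max m (max N (dist_g z x)) \<le> path_length p" for p
  proof -
    have "p \<in> near_paths z (path_length p)" using p by (simp add: near_paths_def)
    then have "c * real (path_length p) < path_weight \<omega> p" using lower p(4) by simp
    moreover have "M / c \<le> real (path_length p)" using m p(4) by linarith
    then have "M \<le> c * real (path_length p)" using c by (simp add: pos_divide_le_eq mult.commute)
    ultimately show ?thesis by simp
  qed
  then show "\<exists>N. \<forall>p. finite_path V E p \<and> distinct p \<and> hd p = x \<and> N \<le> path_length p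
      \<longrightarrow> M \<le> path_weight \<omega> p" by blast
qed (use that in blast)

section \<open>Bi-infinite geodesics as limits\<close>

text \<open>Passing to a subsequence that is constant at one index is possible by the pigeonhole principle;
  the diagonal construction does this for all indices, in the order given by \<open>int_decode\<close>.\<close>

lemma diagonal_subsequence:
  fixes h :: "nat \<Rightarrow> int \<Rightarrow> 'a"
  assumes "\<And>i. finite (range (\<lambda>n. h n i))"
  obtains \<phi> g where "strict_mono \<phi>" "\<And>i. eventually (\<lambda>n. h (\<phi> n) i = g i) sequentially"
proof -
  define Q where "Q k s \<longleftrightarrow> (\<exists>v. \<forall>n. h (s n) (int_decode k) = v)" for k and s :: "nat \<Rightarrow> nat"
  interpret subseqs Q
  proof
    fix k and s :: "nat \<Rightarrow> nat"
    assume "strict_mono s"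
    have "finite (range (\<lambda>n. h (s n) (int_decode k)))"
      by (rule finite_subset[OF _ assms[of "int_decode k"]]) auto
    then obtain m where m: "infinite {n. h (s n) (int_decode k) = h (s m) (int_decode k)}"
      using pigeonhole_infinite[OF infinite_UNIV_nat, of "\<lambda>n. h (s n) (int_decode k)"] by auto
    have "strict_mono (enumerate {n. h (s n) (int_decode k) = h (s m) (int_decode k)})"
      using m by (rule strict_mono_enumerate)
    moreover have "Q k (s \<circ> enumerate {n. h (s n) (int_decode k) = h (s m) (int_decode k)})"
      using enumerate_in_set[OF m] by (auto simp: Q_def)
    ultimately show "\<exists>r. strict_mono r \<and> Q k (s \<circ> r)" by blast
  qed
  have "\<exists>v. eventually (\<lambda>n. h (diagseq n) i = v) sequentially" for i
  proof -
    have "Q (int_encode i) (diagseq \<circ> ((+) (Suc (int_encode i))))"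
      by (rule diagseq_holds) (auto simp: Q_def)
    then obtain v where v: "\<And>n. h (diagseq (Suc (int_encode i) + n)) i = v"
      by (auto simp: Q_def)
    have "h (diagseq n) i = v" if "Suc (int_encode i) \<le> n" for n
      using v[of "n - Suc (int_encode i)"] that by simp
    then show ?thesis unfolding eventually_sequentially by blast
  qed
  then obtain g where "\<And>i. eventually (\<lambda>n. h (diagseq n) i = g i) sequentially" by metis
  then show ?thesis using that subseq_diagseq by blast
qed

text \<open>Recentred at a visit to the fixed ball, the \<open>i\<close>-th vertex of each geodesic lies in a finite set
  that depends only on \<open>i\<close>, so a subsequence converges at every index. Both ends recede from the ball,
  so every finite window of the limit is a genuine piece of one of the geodesics.\<close>

lemma bi_infinite_geodesic_limit:
  assumes nonneg: "\<forall>e\<in>E. 0 \<le> \<omega> e" and z: "z \<in> V"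
    and geo: "\<And>n. weighted_geodesic V E \<omega> (x n) (y n) (P n)"
    and meets: "\<And>n. \<exists>v\<in>set (P n). dist_g z v \<le> R"
    and x_inf: "\<And>m. eventually (\<lambda>n. m \<le> dist_g z (x n)) sequentially"
    and y_inf: "\<And>m. eventually (\<lambda>n. m \<le> dist_g z (y n)) sequentially"
  shows "\<exists>g. bi_infinite_geodesic V E \<omega> g"
proof -
  have pb: "path_between V E (x n) (y n) (P n)" for n using geo by (simp add: weighted_geodesic_def)
  then have fp: "finite_path V E (P n)" for n by (simp add: path_between_def)
  have "\<exists>k\<le>path_length (P n). dist_g z (P n ! k) \<le> R" for n
    using meets[of n] in_set_path_nth[OF fp, of _ n] by metis
  then obtain \<tau> where \<tau>: "\<And>n. \<tau> n \<le> path_length (P n)" "\<And>n. dist_g z (P n ! \<tau> n) \<le> R" by metis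
  have PV: "P n ! k \<in> V" if "k \<le> path_length (P n)" for n k using finite_path_nth[OF fp that] .
  \<comment> \<open>The \<open>n\<close>-th geodesic, recentred at its visit to the ball and extended by its end points.\<close>
  define pos where "pos n i = nat (max 0 (min (int (\<tau> n) + i) (int (path_length (P n)))))" for n i
  define h where "h n i = P n ! pos n i" for n i
  have pos_le: "pos n i \<le> path_length (P n)" for n i by (simp add: pos_def)
  have "dist_g z (h n i) \<le> R + nat \<bar>i\<bar>" for n i
  proof -
    have "dist_g (P n ! \<tau> n) (P n ! pos n i) \<le> nat \<bar>i\<bar>"
    proof (cases "\<tau> n \<le> pos n i")
      case True
      have "pos n i - \<tau> n \<le> nat \<bar>i\<bar>" by (simp add: pos_def)
      then show ?thesis using dist_le_diff[OF fp True pos_le] by simp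
    next
      case False
      have "\<tau> n - pos n i \<le> nat \<bar>i\<bar>" using \<tau>(1)[of n] unfolding pos_def by linarith
      then show ?thesis
        using dist_le_diff[OF fp _ \<tau>(1), of "pos n i" n] False dist_commute[OF PV[OF \<tau>(1)] PV[OF pos_le]]
        by simp
    qed
    then show ?thesis
      using dist_triangle[OF z PV[OF \<tau>(1)] PV[OF pos_le], of n i n] \<tau>(2)[of n] by (simp add: h_def)
  qed
  then have "range (\<lambda>n. h n i) \<subseteq> {v\<in>V. dist_g z v \<le> R + nat \<bar>i\<bar>}" for i
    using PV[OF pos_le] by (auto simp: h_def)
  then have "finite (range (\<lambda>n. h n i))" for i
    by (rule finite_subset[OF _ finite_ball[OF z]])
  then obtain \<phi> g where \<phi>: "strict_mono \<phi>" and g: "\<And>i. eventually (\<lambda>n. h (\<phi> n) i = g i) sequentially"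
    using diagonal_subsequence[of h] by blast
  have inner: "eventually (\<lambda>n. 0 \<le> int (\<tau> n) + i \<and> int (\<tau> n) + i \<le> int (path_length (P n))) sequentially" for i
    using x_inf[of "R + nat \<bar>i\<bar>"] y_inf[of "R + nat \<bar>i\<bar>"]
  proof eventually_elim
    case (elim n)
    have end_nodes: "P n ! 0 = x n" "P n ! path_length (P n) = y n" using path_between_nth[OF pb] by auto
    have "dist_g (x n) (P n ! \<tau> n) \<le> \<tau> n"
      using dist_le_diff[OF fp _ \<tau>(1), of 0 n] end_nodes by simp
    moreover have "dist_g z (x n) \<le> dist_g z (P n ! \<tau> n) + dist_g (x n) (P n ! \<tau> n)"
      using dist_triangle[OF z PV[OF \<tau>(1)] path_between_in_V(1)[OF pb], of n n]
        dist_commute[OF PV[OF \<tau>(1)] path_between_in_V(1)[OF pb], of n n] by simp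
    moreover have "dist_g (P n ! \<tau> n) (y n) \<le> path_length (P n) - \<tau> n"
      using dist_le_diff[OF fp \<tau>(1) order_refl] end_nodes by metis
    moreover have "dist_g z (y n) \<le> dist_g z (P n ! \<tau> n) + dist_g (P n ! \<tau> n) (y n)"
      using dist_triangle[OF z PV[OF \<tau>(1)] path_between_in_V(2)[OF pb], of n n] .
    ultimately show ?case using elim \<tau>(1)[of n] \<tau>(2)[of n] by linarith
  qed
  \<comment> \<open>Every finite window of the limit is read off a single geodesic, starting at index \<open>a\<close>.\<close>
  have window: "\<exists>n a. a + nat (j - i) \<le> path_length (P n) \<and> (\<forall>k\<le>nat (j - i). P n ! (a + k) = g (i + int k))"
    if "i \<le> j" for i j
  proof -
    have "eventually (\<lambda>n. \<forall>k\<in>{i..j}. h (\<phi> n) k = g k) sequentially"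
      by (rule eventually_ball_finite) (use g in auto)
    moreover have "eventually (\<lambda>n. 0 \<le> int (\<tau> (\<phi> n)) + k \<and> int (\<tau> (\<phi> n)) + k \<le> int (path_length (P (\<phi> n)))) sequentially" for k
      using eventually_subseq[OF \<phi> inner[of k]] .
    ultimately have "eventually (\<lambda>n. (\<forall>k\<in>{i..j}. h (\<phi> n) k = g k) \<and> 0 \<le> int (\<tau> (\<phi> n)) + i
        \<and> int (\<tau> (\<phi> n)) + j \<le> int (path_length (P (\<phi> n)))) sequentially"
      by (auto simp: eventually_conj_iff)
    then obtain m where m: "\<And>k. i \<le> k \<Longrightarrow> k \<le> j \<Longrightarrow> h (\<phi> m) k = g k" "0 \<le> int (\<tau> (\<phi> m)) + i"
        "int (\<tau> (\<phi> m)) + j \<le> int (path_length (P (\<phi> m)))"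
      using eventually_happens by fastforce
    let ?a = "nat (int (\<tau> (\<phi> m)) + i)"
    have "P (\<phi> m) ! (?a + k) = g (i + int k)" if "k \<le> nat (j - i)" for k
    proof -
      have "pos (\<phi> m) (i + int k) = ?a + k" using m(2,3) that \<open>i \<le> j\<close> unfolding pos_def by linarith
      then show ?thesis using m(1)[of "i + int k"] that \<open>i \<le> j\<close> by (simp add: h_def)
    qed
    moreover have "?a + nat (j - i) \<le> path_length (P (\<phi> m))" using m(2,3) that by linarith
    ultimately show ?thesis by blast
  qed
  have "bi_infinite_geodesic V E \<omega> g"
    unfolding bi_infinite_geodesic_def bi_infinite_path_def
  proof (intro conjI allI impI)
    fix i
    obtain n a where na: "Suc a \<le> path_length (P n)" "\<forall>k\<le>1. P n ! (a + k) = g (i + int k)"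
      using window[of i "i + 1"] by auto
    have "P n ! a = g i" "P n ! Suc a = g (i + 1)" using na(2)[rule_format, of 0] na(2)[rule_format, of 1] by auto
    then show "g i \<in> V" "{g i, g (i + 1)} \<in> E"
      using PV[of a n] finite_path_edge[OF fp, of a n] na(1) by auto
  next
    fix i j :: int assume ij: "i < j"
    obtain n a where na: "a + nat (j - i) \<le> path_length (P n)" "\<forall>k\<le>nat (j - i). P n ! (a + k) = g (i + int k)"
      using window[of i j] ij by auto
    let ?b = "a + nat (j - i)"
    have gij: "P n ! a = g i" "P n ! ?b = g j"
      using na(2)[rule_format, of 0] na(2)[rule_format, of "nat (j - i)"] ij by auto
    have "slice (P n) a ?b = map g [i..j]"
    proof (rule nth_equalityI)
      show len: "length (slice (P n) a ?b) = length (map g [i..j])"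
        using slice_length(2)[OF fp _ na(1), of a] ij by simp
      fix k assume "k < length (slice (P n) a ?b)"
      then have k: "k \<le> nat (j - i)" using slice_length(2)[OF fp _ na(1), of a] by simp
      then have "slice (P n) a ?b ! k = g (i + int k)"
        using slice_nth[OF fp _ na(1), of a k] na(2) by simp
      also have "\<dots> = map g [i..j] ! k" using k ij by (simp add: nth_upto)
      finally show "slice (P n) a ?b ! k = map g [i..j] ! k" .
    qed
    moreover have "weighted_geodesic V E \<omega> (P n ! a) (P n ! ?b) (slice (P n) a ?b)"
      using weighted_geodesic_slice[OF geo nonneg _ na(1), of a] by simp
    ultimately show "path_weight \<omega> (map g [i..j]) = weighted_dist V E \<omega> (g i) (g j)"
      using gij by (simp add: weighted_geodesic_def)
  qed
  then show ?thesis by blast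
qed

lemma quasi_geodesic_to_infinity:
  assumes "quasi_geodesic_bi_infinite V E C K \<gamma>" "1 \<le> C" "0 \<le> K"
  shows "eventually (\<lambda>n. m \<le> dist_g (\<gamma> 0) (\<gamma> (int n))) sequentially"
    and "eventually (\<lambda>n. m \<le> dist_g (\<gamma> 0) (\<gamma> (- int n))) sequentially"
proof -
  have inV: "\<gamma> k \<in> V" for k
    using assms by (simp add: quasi_geodesic_bi_infinite_def bi_infinite_path_def)
  have q: "real_of_int (j - i) \<le> C * real (dist_g (\<gamma> i) (\<gamma> j)) + K" if "i < j" for i j
    using assms that by (simp add: quasi_geodesic_bi_infinite_def)
  obtain M :: nat where M: "C * real m + K < real M" using reals_Archimedean2 by blast
  have key: "m \<le> d" if "M \<le> n" "real n \<le> C * real d + K" for n d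
  proof (rule ccontr)
    assume "\<not> m \<le> d"
    then have "C * real d \<le> C * real m" using assms by (intro mult_left_mono) auto
    then show False using M that by linarith
  qed
  have "0 \<le> C * real m" using assms by simp
  then have "0 < real M" using M assms by linarith
  then have M0: "0 < M" by simp
  have "m \<le> dist_g (\<gamma> 0) (\<gamma> (int n)) \<and> m \<le> dist_g (\<gamma> 0) (\<gamma> (- int n))" if "M \<le> n" for n
    using key[OF that] q[of 0 "int n"] q[of "- int n" 0] dist_commute[OF inV inV, of "- int n" 0] that M0
    by simp
  then show "eventually (\<lambda>n. m \<le> dist_g (\<gamma> 0) (\<gamma> (int n))) sequentially"
    "eventually (\<lambda>n. m \<le> dist_g (\<gamma> 0) (\<gamma> (- int n))) sequentially"
    unfolding eventually_sequentially by blast+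
qed

end

section \<open>Almost sure crossing and existence\<close>

context fpp
begin

lemma AE_edges_pos:
  assumes "measure \<nu> {0} = 0"
  shows "AE \<omega> in fpp_measure E \<nu>. \<forall>e\<in>E. 0 < \<omega> e"
proof (subst AE_ball_countable[OF countable_edges], intro ballI)
  fix e assume "e \<in> E"
  then show "AE \<omega> in fpp_measure E \<nu>. 0 < \<omega> e"
    unfolding fpp_measure_def
    by (intro AE_PiM_component prob_space_axioms AE_law_pos assms)
qed

text \<open>One event of full measure serves all pairs of vertices on opposite sides of \<open>\<gamma> 0\<close> at once, so it
  yields both the bi-infinite geodesic and the crossing property for any given sequence of pairs.\<close>

lemma geodesics_cross_ball:
  assumes morse: "morse_quasi_geodesic V E \<gamma>" and "measure \<nu> {0} = 0"
    and "0 < c" "exp_moment c < \<infinity>"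
  shows "AE \<omega> in fpp_measure E \<nu>. (\<forall>e\<in>E. 0 < \<omega> e)
    \<and> (\<forall>x\<in>V. \<forall>y\<in>V. \<exists>p. weighted_geodesic V E \<omega> x y p)
    \<and> (\<exists>R. \<forall>s t p. weighted_geodesic V E \<omega> (\<gamma> s) (\<gamma> t) p \<and> s \<le> 0 \<and> 0 \<le> t
          \<longrightarrow> (\<exists>v\<in>set p. dist_g (\<gamma> 0) v \<le> R))"
proof -
  have z: "\<gamma> 0 \<in> V"
    using morse by (auto simp: morse_quasi_geodesic_def quasi_geodesic_bi_infinite_def bi_infinite_path_def)
  obtain a where a: "0 < a"
    "AE \<omega> in fpp_measure E \<nu>. \<exists>N. \<forall>n\<ge>N. \<forall>p\<in>near_paths (\<gamma> 0) n. a * real n < path_weight \<omega> p"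
    using linear_lower_bound[OF z assms(2)] by blast
  obtain b where b: "0 < b"
    "AE \<omega> in fpp_measure E \<nu>. \<exists>N. \<forall>n\<ge>N. \<forall>p\<in>near_paths (\<gamma> 0) n. path_weight \<omega> p < b * real n"
    using linear_upper_bound[OF z assms(3,4)] by blast
  show ?thesis
    using AE_edges_pos[OF assms(2)] a(2) b(2)
  proof eventually_elim
    case (elim \<omega>)
    then obtain N N' where lower: "\<forall>n\<ge>N. \<forall>p\<in>near_paths (\<gamma> 0) n. a * real n < path_weight \<omega> p"
      and upper: "\<forall>n\<ge>N'. \<forall>p\<in>near_paths (\<gamma> 0) n. path_weight \<omega> p < b * real n" by blast
    have nonneg: "\<forall>e\<in>E. 0 \<le> \<omega> e" using elim(1) by (auto intro: less_imp_le)
    obtain R where "\<And>s t p. \<lbrakk>weighted_geodesic V E \<omega> (\<gamma> s) (\<gamma> t) p; s \<le> 0; 0 \<le> t\<rbrakk>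
        \<Longrightarrow> \<exists>v\<in>set p. dist_g (\<gamma> 0) v \<le> R"
      using geodesics_meet_ball[OF morse elim(1) lower a(1) upper less_imp_le[OF b(1)]] by blast
    moreover have "\<exists>p. weighted_geodesic V E \<omega> x y p" if "x \<in> V" "y \<in> V" for x y
      using geodesic_exists_of_linear_lower_bound[OF z that nonneg lower a(1)] by blast
    ultimately show ?case using elim(1) by blast
  qed
qed

end

lemma weighted_geodesic_rev:
  assumes "weighted_geodesic V E \<omega> x y p" "\<forall>e\<in>E. 0 \<le> \<omega> e"
  shows "weighted_geodesic V E \<omega> y x (rev p)"
proof (rule weighted_geodesicI[OF _ assms(2)])
  have pb: "path_between V E x y p" using assms by (simp add: weighted_geodesic_def)
  then show "path_between V E y x (rev p)" by (rule path_between_rev)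
  fix q assume "path_between V E y x q"
  note q = path_between_rev[OF this]
  show "path_weight \<omega> (rev p) \<le> path_weight \<omega> q"
    using weighted_geodesic_le[OF assms q(1)] q(3) path_between_rev(3)[OF pb] by simp
qed

theorem theorem1p4:
  fixes V :: "'v set" and E :: "'v set set"
    and \<gamma> :: "int \<Rightarrow> 'v" and \<nu> :: "real measure"
  assumes "simple_graph V E"
    and "infinite V"
    and "connected_graph V E"
    and "bounded_degree V E"
    and "morse_quasi_geodesic V E \<gamma>"
    and "prob_space \<nu>"
    and "sets \<nu> = sets (restrict_space borel {0..})"
    and "measure \<nu> {0} = 0"
    and "\<exists>c>0. \<forall>e\<in>E. (\<integral>\<^sup>+\<omega>. ennreal (exp (c * \<omega> e)) \<partial>fpp_measure E \<nu>) < \<infinity>"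
  shows "(AE \<omega> in fpp_measure E \<nu>. \<exists>g. bi_infinite_geodesic V E \<omega> g) \<and>
    (\<forall>x y. to_infinity_on_opposite_sides \<gamma> x y \<longrightarrow>
       (AE \<omega> in fpp_measure E \<nu>. \<exists>A. finite A \<and> A \<subseteq> V \<and>
          (\<forall>n p. weighted_geodesic V E \<omega> (x n) (y n) p \<longrightarrow> set p \<inter> A \<noteq> {})))"
proof -
  obtain D where D: "\<And>v. v \<in> V \<Longrightarrow> finite {e\<in>E. v \<in> e}" "\<And>v. v \<in> V \<Longrightarrow> card {e\<in>E. v \<in> e} \<le> D"
    using assms(4) unfolding bounded_degree_def by blast
  have "card {e\<in>E. v \<in> e} \<le> max D 1" if "v \<in> V" for v using D(2)[OF that] by simp
  then interpret fpp V E "max D 1" \<nu>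
    using assms(1,3,6,7) D(1)
    by (intro fpp.intro bounded_degree_graph.intro edge_law.intro edge_law_axioms.intro) auto
  obtain C K where CK: "1 \<le> C" "0 \<le> K" "quasi_geodesic_bi_infinite V E C K \<gamma>"
    using assms(5) unfolding morse_quasi_geodesic_def by blast
  have \<gamma>: "\<gamma> k \<in> V" "{\<gamma> k, \<gamma> (k + 1)} \<in> E" for k
    using CK(3) unfolding quasi_geodesic_bi_infinite_def bi_infinite_path_def by auto
  obtain c where c: "0 < c" "\<forall>e\<in>E. (\<integral>\<^sup>+\<omega>. ennreal (exp (c * \<omega> e)) \<partial>fpp_measure E \<nu>) < \<infinity>"
    using assms(9) by blast
  have "(\<integral>\<^sup>+\<omega>. ennreal (exp (c * \<omega> {\<gamma> 0, \<gamma> (0 + 1)})) \<partial>fpp_measure E \<nu>) = exp_moment c"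
    unfolding exp_moment_def by (rule nn_integral_edge[OF \<gamma>(2)]) simp
  then have "exp_moment c < \<infinity>" using c(2) \<gamma>(2) by metis
  note cross = geodesics_cross_ball[OF assms(5,8) c(1) this]
  show ?thesis
  proof (intro conjI allI impI)
    show "AE \<omega> in fpp_measure E \<nu>. \<exists>g. bi_infinite_geodesic V E \<omega> g"
      using cross
    proof eventually_elim
      case (elim \<omega>)
      then obtain R where pos: "\<forall>e\<in>E. 0 < \<omega> e"
        and exists: "\<And>x y. x \<in> V \<Longrightarrow> y \<in> V \<Longrightarrow> \<exists>p. weighted_geodesic V E \<omega> x y p"
        and R: "\<And>s t p. weighted_geodesic V E \<omega> (\<gamma> s) (\<gamma> t) p \<Longrightarrow> s \<le> 0 \<Longrightarrow> 0 \<le> t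
          \<Longrightarrow> \<exists>v\<in>set p. dist_g (\<gamma> 0) v \<le> R" by blast
      have nonneg: "\<forall>e\<in>E. 0 \<le> \<omega> e" using pos by (auto intro: less_imp_le)
      have "\<forall>n. \<exists>p. weighted_geodesic V E \<omega> (\<gamma> (- int n)) (\<gamma> (int n)) p" using exists \<gamma>(1) by blast
      then obtain P where P: "\<And>n. weighted_geodesic V E \<omega> (\<gamma> (- int n)) (\<gamma> (int n)) (P n)" by metis
      have meets: "\<exists>v\<in>set (P n). dist_g (\<gamma> 0) v \<le> R" for n using R[OF P] by simp
      show ?case
        by (rule bi_infinite_geodesic_limit[OF nonneg \<gamma>(1), of "\<lambda>n. \<gamma> (- int n)" "\<lambda>n. \<gamma> (int n)" P 0 R])
          (rule P meets quasi_geodesic_to_infinity[OF CK(3,1,2)])+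
    qed
  next
    fix x y assume "to_infinity_on_opposite_sides \<gamma> x y"
    then obtain s t where st: "\<And>n. x n = \<gamma> (s n)" "\<And>n. y n = \<gamma> (t n)"
      and lim: "filterlim s at_bot sequentially \<and> filterlim t at_top sequentially \<or>
         filterlim s at_top sequentially \<and> filterlim t at_bot sequentially"
      unfolding to_infinity_on_opposite_sides_def by blast
    have "eventually (\<lambda>n. s n \<le> 0 \<and> 0 \<le> t n \<or> 0 \<le> s n \<and> t n \<le> 0) sequentially"
      using lim
    proof
      assume "filterlim s at_bot sequentially \<and> filterlim t at_top sequentially"
      then have "eventually (\<lambda>n. s n \<le> 0) sequentially" "eventually (\<lambda>n. 0 \<le> t n) sequentially"
        by (auto simp: filterlim_at_bot filterlim_at_top)
      then show ?thesis by eventually_elim simp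
    next
      assume "filterlim s at_top sequentially \<and> filterlim t at_bot sequentially"
      then have "eventually (\<lambda>n. 0 \<le> s n) sequentially" "eventually (\<lambda>n. t n \<le> 0) sequentially"
        by (auto simp: filterlim_at_bot filterlim_at_top)
      then show ?thesis by eventually_elim simp
    qed
    then obtain N where N: "\<And>n. N \<le> n \<Longrightarrow> s n \<le> 0 \<and> 0 \<le> t n \<or> 0 \<le> s n \<and> t n \<le> 0"
      unfolding eventually_sequentially by blast
    show "AE \<omega> in fpp_measure E \<nu>. \<exists>A. finite A \<and> A \<subseteq> V \<and>
          (\<forall>n p. weighted_geodesic V E \<omega> (x n) (y n) p \<longrightarrow> set p \<inter> A \<noteq> {})"
      using cross
    proof eventually_elim
      case (elim \<omega>)
      then obtain R where pos: "\<forall>e\<in>E. 0 < \<omega> e"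
        and R: "\<And>s t p. weighted_geodesic V E \<omega> (\<gamma> s) (\<gamma> t) p \<Longrightarrow> s \<le> 0 \<Longrightarrow> 0 \<le> t
          \<Longrightarrow> \<exists>v\<in>set p. dist_g (\<gamma> 0) v \<le> R" by blast
      have nonneg: "\<forall>e\<in>E. 0 \<le> \<omega> e" using pos by (auto intro: less_imp_le)
      \<comment> \<open>Pairs that are not yet on opposite sides of \<open>\<gamma> 0\<close> are taken care of by their starting points.\<close>
      let ?A = "{v\<in>V. dist_g (\<gamma> 0) v \<le> R} \<union> x ` {..<N}"
      have "set p \<inter> ?A \<noteq> {}" if p: "weighted_geodesic V E \<omega> (x n) (y n) p" for n p
      proof -
        have pb: "p \<noteq> []" "hd p = x n" "set p \<subseteq> V"
          using p by (auto simp: weighted_geodesic_def path_between_def finite_path_def)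
        show ?thesis
        proof (cases "n < N")
          case True
          then have "hd p \<in> set p \<inter> ?A" using pb hd_in_set[of p] by auto
          then show ?thesis by blast
        next
          case False
          have "\<exists>v\<in>set p. dist_g (\<gamma> 0) v \<le> R"
            using N[of n] False R[of "s n" "t n" p] R[of "t n" "s n" "rev p"] p
              weighted_geodesic_rev[OF p nonneg] by (auto simp: st)
          then show ?thesis using pb(3) by blast
        qed
      qed
      moreover have "finite ?A" "?A \<subseteq> V" using finite_ball[OF \<gamma>(1)] st(1) \<gamma>(1) by auto
      ultimately show ?case by blast
    qed
  qed
qed

end
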